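(* For every integer $n\ge 1$, $$|AI_{2n}(1243)|=|AI_{2n}(2143)|=|AI_{2n}(2134)|=M_n$$ and $$|AI_{2n-1}(2134)|=|RAI_{2n-1}(1243)|=M_n-M_{n-2},$$ where $M_k$ is the $k$-th Motzkin number and $M_k=0$ for $k<0$.
   Context: Let $S_n$ be the set of permutations $\pi=\pi_1\ldots\pi_n$ of $\{1,\ldots,n\}$. A permutation is alternating if, for all $1\le i\le n-1$, $\pi_i<\pi_{i+1}$ if and only if $i$ is odd; it is reverse alternating if, for all $1\le i\le n-1$, $\pi_i>\pi_{i+1}$ if and only if $i$ is odd. $AI_n$ (resp. $RAI_n$) is the set of alternating (resp. reverse alternating) involutions ($\pi=\pi^{-1}$) in $S_n$. A permutation $\pi\in S_n$ avoids the pattern $\tau\in S_k$ if there are no indices $i_1<\cdots<i_k$ such that $\pi_{i_1}\ldots\pi_{i_k}$ is order-isomorphic to $\tau$; $AI_n(\tau)$ and $RAI_n(\tau)$ are the subsets of elements avoiding $\tau$. The Motzkin number $M_n$ ($n\ge 0$) is the number of Motzkin paths of length $n$, i.e. lattice paths from $(0,0)$ to $(n,0)$ with steps $U=(1,1)$, $D=(1,-1)$, $H=(1,0)$ that stay weakly above the $x$-axis (so $M_0=M_1=1$, $M_2=2$, $M_3=4$). *)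

theory Defs
  imports "HOL-Combinatorics.Permutations"
begin

text \<open>
  An element of \<open>S\<^sub>n\<close> is a function \<open>p\<close> with \<open>p permutes {1..n}\<close>, with \<open>p i\<close> in the role of
  \<open>\<pi>\<^sub>i\<close>. Such a function is the identity outside \<open>{1..n}\<close>, so distinct functions are distinct
  permutations and \<open>inv p\<close> is the inverse in \<open>S\<^sub>n\<close>.
\<close>

definition alternating :: "nat \<Rightarrow> (nat \<Rightarrow> nat) \<Rightarrow> bool" where
  "alternating n p \<longleftrightarrow> (\<forall>i. 1 \<le> i \<and> i < n \<longrightarrow> (p i < p (i + 1) \<longleftrightarrow> odd i))"

definition reverse_alternating :: "nat \<Rightarrow> (nat \<Rightarrow> nat) \<Rightarrow> bool" where
  "reverse_alternating n p \<longleftrightarrow> (\<forall>i. 1 \<le> i \<and> i < n \<longrightarrow> (p i > p (i + 1) \<longleftrightarrow> odd i))"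

text \<open>
  A pattern in \<open>S\<^sub>k\<close> is given by its one-line notation, a list of length \<open>k\<close>; its entries are
  indexed from \<open>0\<close>, whereas positions in \<open>p\<close> start at \<open>1\<close>. The function \<open>f\<close> lists the
  indices \<open>i\<^sub>1 < \<dots> < i\<^sub>k\<close>.
\<close>

definition contains_pattern :: "nat \<Rightarrow> (nat \<Rightarrow> nat) \<Rightarrow> nat list \<Rightarrow> bool" where
  "contains_pattern n p \<tau> \<longleftrightarrow>
    (\<exists>f :: nat \<Rightarrow> nat. strict_mono_on {..<length \<tau>} f \<and> f ` {..<length \<tau>} \<subseteq> {1..n} \<and>
      (\<forall>a < length \<tau>. \<forall>b < length \<tau>. p (f a) < p (f b) \<longleftrightarrow> \<tau> ! a < \<tau> ! b))"

abbreviation avoids_pattern :: "nat \<Rightarrow> (nat \<Rightarrow> nat) \<Rightarrow> nat list \<Rightarrow> bool" where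
  "avoids_pattern n p \<tau> \<equiv> \<not> contains_pattern n p \<tau>"

definition AI :: "nat \<Rightarrow> (nat \<Rightarrow> nat) set" where
  "AI n = {p. p permutes {1..n} \<and> p = inv p \<and> alternating n p}"

definition RAI :: "nat \<Rightarrow> (nat \<Rightarrow> nat) set" where
  "RAI n = {p. p permutes {1..n} \<and> p = inv p \<and> reverse_alternating n p}"

definition AI_avoiding :: "nat \<Rightarrow> nat list \<Rightarrow> (nat \<Rightarrow> nat) set" where
  "AI_avoiding n \<tau> = {p \<in> AI n. avoids_pattern n p \<tau>}"

definition RAI_avoiding :: "nat \<Rightarrow> nat list \<Rightarrow> (nat \<Rightarrow> nat) set" where
  "RAI_avoiding n \<tau> = {p \<in> RAI n. avoids_pattern n p \<tau>}"

datatype motzkin_step = Up | Down | Level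

fun rise :: "motzkin_step \<Rightarrow> int" where
  "rise Up = 1"
| "rise Down = -1"
| "rise Level = 0"

text \<open>
  A path starting at \<open>(0, 0)\<close> is given by its list of steps; after \<open>k\<close> steps it is at the
  point whose abscissa is \<open>k\<close> and whose ordinate is the height defined here.
\<close>

definition height_after :: "nat \<Rightarrow> motzkin_step list \<Rightarrow> int" where
  "height_after k xs = (\<Sum>s\<leftarrow>take k xs. rise s)"

definition motzkin_paths :: "nat \<Rightarrow> motzkin_step list set" where
  "motzkin_paths n =
    {xs. length xs = n \<and> (\<forall>k\<le>n. height_after k xs \<ge> 0) \<and> height_after n xs = 0}"

text \<open>The index is an integer so that the convention \<open>M\<^sub>k = 0\<close> for \<open>k < 0\<close> can be expressed.\<close>

definition motzkin :: "int \<Rightarrow> nat" where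
  "motzkin k = (if k < 0 then 0 else card (motzkin_paths (nat k)))"

end

theory Submission
  imports Defs
begin

text \<open>
  Two reductions lead to the pattern \<open>1234\<close>. The reverse-complement exchanges \<open>1243\<close> and \<open>2134\<close> and
  preserves involutions. A Ferrers board argument exchanges the prefixes \<open>12\<close> and \<open>21\<close> of the patterns
  \<open>12 \<oplus> \<tau>\<close> and \<open>21 \<oplus> \<tau>\<close>: the entries that have a copy of \<open>\<tau>\<close> above and to the right of them lie
  in a symmetric Ferrers board, and among the fillings of this board with the same rows and columns
  exactly one avoids \<open>12\<close> and exactly one avoids \<open>21\<close>; by uniqueness both are symmetric. In an
  alternating permutation that avoids either pattern no peak is such an entry, so refilling the
  board keeps the permutation alternating.

  Involutions avoiding \<open>1234\<close> correspond under Robinson--Schensted to standard tableaux with at most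
  three columns, ascents at odd positions meaning that the next box lies strictly further right. So
  the boxes of an alternating tableau come in pairs in two different columns, and a tableau with
  column heights \<open>a \<ge> b \<ge> c\<close> has as many extensions by \<open>n\<close> pairs as there are Motzkin paths of length
  \<open>n\<close> from a height \<open>i + j\<close> with \<open>i \<le> a - b\<close>, \<open>j \<le> b - c\<close> to the axis (the branching rule from \<open>GL\<^sub>3\<close>
  to \<open>GL\<^sub>2\<close>). A single last box is possible in as many ways as a last pair, except that the third
  column is excluded after a pair in the first two columns; this accounts for the term \<open>M\<^bsub>n-2\<^esub>\<close>.
\<close>

subsection \<open>Robinson--Schensted for involutions by growth diagrams\<close>

text \<open>
  Fomin's local rule with partitions replaced by edge labels: \<open>growth_label p i j\<close> is the row of the box
  added along the horizontal edge from \<open>(i, j)\<close> to \<open>(i + 1, j)\<close>, or \<open>0\<close> if the partition does not change.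
  For an involution the diagram is symmetric, so the vertical edge from \<open>(i, j)\<close> to \<open>(i, j + 1)\<close> carries
  the label \<open>growth_label p j i\<close>.
\<close>

function growth_label :: "(nat \<Rightarrow> nat) \<Rightarrow> nat \<Rightarrow> nat \<Rightarrow> nat" where
  "growth_label p i 0 = 0"
| "growth_label p i (Suc j) =
    (if growth_label p i j \<noteq> growth_label p j i then growth_label p i j
     else if growth_label p i j > 0 then Suc (growth_label p i j)
     else if p (Suc i) = Suc j then 1 else 0)"
  by pat_completeness auto
termination by (relation "measure (\<lambda>(p, i, j). i + j)") auto

declare growth_label.simps(2) [simp del]

text \<open>For \<open>r > 0\<close> this is the \<open>r\<close>-th part of the partition at the
  vertex \<open>(i, j)\<close>, collected along the horizontal line at height
  \<open>j\<close>.\<close>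

definition label_count :: "(nat \<Rightarrow> nat) \<Rightarrow> nat \<Rightarrow> nat \<Rightarrow> nat \<Rightarrow> nat" where
  "label_count p r i j = card {i'. i' < i \<and> growth_label p i' j = r}"

lemma label_count_0 [simp]: "label_count p r 0 j = 0"
  by (simp add: label_count_def)

lemma label_count_Suc:
  "label_count p r (Suc i) j = label_count p r i j + of_bool (growth_label p i j = r)"
proof -
  have "{i'. i' < Suc i \<and> growth_label p i' j = r} =
      (if growth_label p i j = r then insert i {i'. i' < i \<and> growth_label p i' j = r}
       else {i'. i' < i \<and> growth_label p i' j = r})"
    by (auto simp: less_Suc_eq)
  then show ?thesis by (simp add: label_count_def)
qed

locale involution_on =
  fixes N :: nat and p :: "nat \<Rightarrow> nat"
  assumes permutes: "p permutes {1..N}" and involutive: "p (p i) = i"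
begin

lemma symmetric: "p i = j \<longleftrightarrow> p j = i"
  using involutive by auto

lemma Suc_pos: "p (Suc i) > 0"
  using permutes involutive permutes_not_in[OF permutes, of 0] by (metis atLeastAtMost_iff not_gr_zero not_one_le_zero nat.distinct(1))

lemma le_N: "i < N \<Longrightarrow> p (Suc i) \<le> N"
  using permutes_in_image[OF permutes, of "Suc i"] by simp

lemma inj: "p i = p j \<longleftrightarrow> i = j"
  by (metis involutive)

abbreviation "L \<equiv> growth_label p"
abbreviation "c \<equiv> label_count p"

text \<open>Each column of cells holds one point, and its label turns positive at that point and
  never returns to \<open>0\<close>.\<close>

lemma label_pos_iff: "L i j > 0 \<longleftrightarrow> p (Suc i) \<le> j"
proof (induction "i + j" arbitrary: i j rule: less_induct)
  case less
  show ?case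
  proof (cases j)
    case 0
    then show ?thesis using Suc_pos[of i] by simp
  next
    case (Suc k)
    have 1: "L i k > 0 \<longleftrightarrow> p (Suc i) \<le> k" using less Suc by simp
    have 2: "L k i > 0 \<longleftrightarrow> p (Suc k) \<le> i" using less Suc by simp
    have 3: "p (Suc i) = Suc k \<longleftrightarrow> p (Suc k) = Suc i" using symmetric by auto
    show ?thesis using 1 2 3 by (auto simp: growth_label.simps(2) Suc le_Suc_eq)
  qed
qed

text \<open>The inverse local rule. Distinct labels cross a cell unchanged, equal ones leave it
  equal; the truncated subtraction also covers a cell without point and with labels
  \<open>0\<close>.\<close>

lemma label_step_back:
  "L i j = (if L i (Suc j) = L j (Suc i) then L i (Suc j) - 1 else L i (Suc j))"
  using symmetric[of "Suc i" "Suc j"] by (auto simp: growth_label.simps(2))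

text \<open>Path independence: both routes around a cell add the same boxes. The left boundary
  carries only label \<open>0\<close>, which is not a box, hence \<open>r > 0\<close>.\<close>

lemma label_count_Suc_right:
  assumes "r > 0"
  shows "c r i (Suc j) = c r i j + of_bool (L j i = r)"
proof (induction i)
  case 0
  then show ?case using assms by simp
next
  case (Suc i)
  have "of_bool (L j i = r) + of_bool (L i (Suc j) = r) =
      (of_bool (L i j = r) + of_bool (L j (Suc i) = r) :: nat)"
    using symmetric[of "Suc i" "Suc j"] by (simp add: growth_label.simps(2))
  then show ?case using Suc by (simp add: label_count_Suc)
qed

text \<open>The local rule preserves partitions. Boxes in distinct rows give the union of two
  partitions; a box pushed from row \<open>s\<close> to row \<open>Suc s\<close> has room because
  row \<open>s\<close> has just grown.\<close>

lemma label_count_antitone: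
  assumes "r > 0"
  shows "c (Suc r) i j \<le> c r i j"
  using assms
proof (induction "i + j" arbitrary: i j r rule: less_induct)
  case less
  show ?case
  proof (cases i)
    case 0
    then show ?thesis by simp
  next
    case i: (Suc i')
    show ?thesis
    proof (cases j)
      case 0
      then show ?thesis using less.prems by (simp add: label_count_def)
    next
      case j: (Suc j')
      define a b where "a = L i' j'" and "b = L j' i'"
      have IH: "c (Suc s) i' j' \<le> c s i' j'" "c (Suc s) (Suc i') j' \<le> c s (Suc i') j'"
        "c (Suc s) i' (Suc j') \<le> c s i' (Suc j')" if "s > 0" for s
        using less.hyps[of _ _ s] that i j by auto
      have c1: "c s (Suc i') j' = c s i' j' + of_bool (a = s)" for s
        by (simp add: label_count_Suc a_def)
      have c2: "c s i' (Suc j') = c s i' j' + of_bool (b = s)" if "s > 0" for s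
        using that by (simp add: label_count_Suc_right b_def)
      have c3: "c s (Suc i') (Suc j') = c s i' (Suc j') + of_bool (L i' (Suc j') = s)" for s
        by (simp add: label_count_Suc)
      have L: "L i' (Suc j') = (if a \<noteq> b then a else if a > 0 then Suc a
          else if p (Suc i') = Suc j' then 1 else 0)"
        by (simp add: growth_label.simps(2) a_def b_def)
      show ?thesis
        using IH(1)[of r] IH(2)[of r] IH(3)[of r] less.prems c1[of r] c1[of "Suc r"] c2[of r]
          c2[of "Suc r"] c3[of r] c3[of "Suc r"] unfolding i j L
        by (auto split: if_splits simp: of_bool_def)
    qed
  qed
qed

section \<open>Increasing chains and the length of the first row\<close>

fun chain :: "nat \<Rightarrow> nat \<Rightarrow> nat \<Rightarrow> bool" where
  "chain 0 i j \<longleftrightarrow> True"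
| "chain (Suc k) i j \<longleftrightarrow> (\<exists>i'<i. \<exists>j'<j. p (Suc i') = Suc j' \<and> chain k i' j')"

lemma chain_Suc_Suc:
  "chain (Suc k) (Suc i) (Suc j) \<longleftrightarrow>
    chain (Suc k) i (Suc j) \<or> chain (Suc k) (Suc i) j \<or> (p (Suc i) = Suc j \<and> chain k i j)"
  by (auto simp: less_Suc_eq)

text \<open>Schensted's theorem. Longest chain and first part satisfy the same recursion: the value
  at the far corner of a cell is the maximum of the two neighbouring corners, except that a point in
  the cell makes it one more than the near corner.\<close>

lemma chain_iff_label_count: "chain k i j \<longleftrightarrow> k \<le> c 1 i j"
proof (induction "i + j" arbitrary: i j k rule: less_induct)
  case less
  show ?case
  proof (cases k)
    case 0
    then show ?thesis by simp
  next
    case k: (Suc k')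
    show ?thesis
    proof (cases i)
      case 0
      then show ?thesis using k by simp
    next
      case i: (Suc i')
      show ?thesis
      proof (cases j)
        case 0
        then show ?thesis using k by (simp add: label_count_def)
      next
        case j: (Suc j')
        have IH: "chain k' i' j' \<longleftrightarrow> k' \<le> c 1 i' j'" "chain k (Suc i') j' \<longleftrightarrow> k \<le> c 1 (Suc i') j'"
          "chain k i' (Suc j') \<longleftrightarrow> k \<le> c 1 i' (Suc j')"
          using less.hyps i j by auto
        have c1: "c 1 (Suc i') j' = c 1 i' j' + of_bool (L i' j' = 1)"
          by (simp add: label_count_Suc)
        have c2: "c 1 i' (Suc j') = c 1 i' j' + of_bool (L j' i' = 1)"
          by (simp add: label_count_Suc_right)
        have c3: "c 1 (Suc i') (Suc j') = c 1 i' (Suc j') + of_bool (L i' (Suc j') = 1)"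
          by (simp add: label_count_Suc)
        have pt: "p (Suc i') = Suc j' \<Longrightarrow> L i' j' = 0 \<and> L j' i' = 0"
          using label_pos_iff[of i' j'] label_pos_iff[of j' i'] symmetric[of "Suc i'" "Suc j'"] by auto
        have "chain k i j \<longleftrightarrow> k \<le> c 1 i' (Suc j') \<or> k \<le> c 1 (Suc i') j'
            \<or> (p (Suc i') = Suc j' \<and> k' \<le> c 1 i' j')"
          using IH chain_Suc_Suc[of k' i' j'] unfolding i j k by simp
        also have "\<dots> \<longleftrightarrow> k \<le> c 1 i j"
          using pt unfolding i j k c3 c2 c1 growth_label.simps(2) by auto
        finally show ?thesis .
      qed
    qed
  qed
qed

text \<open>Induction up two adjacent columns; the vertical label leaving the left cell enters the
  right one. When a positive right label rises, the left label is already larger, and the point of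
  the right column comes later.\<close>

lemma ascent_label:
  assumes "p (Suc i) < p (Suc (Suc i))"
  shows "L (Suc i) j \<le> L i j"
proof (induction j)
  case (Suc j)
  have pt: "L i j = 0 \<Longrightarrow> p (Suc (Suc i)) \<noteq> Suc j"
    using label_pos_iff[of i j] assms by auto
  have "L j (Suc i) = (if L i j \<noteq> L j i then L j i else L i (Suc j))"
    using symmetric[of "Suc i" "Suc j"] by (simp add: growth_label.simps(2))
  then show ?case using Suc pt
    by (auto simp: growth_label.simps(2)[of p i j] growth_label.simps(2)[of p "Suc i" j])
qed simp

text \<open>The same induction with the right point first: a left label that rises to meet the right
  label pushes it one further. The second disjunct covers heights below both points.\<close>

lemma descent_label:
  assumes "p (Suc i) > p (Suc (Suc i))"
  shows "L (Suc i) j > L i j \<or> (L i j = 0 \<and> L (Suc i) j = 0)"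
proof (induction j)
  case (Suc j)
  have pt: "p (Suc i) = Suc j \<Longrightarrow> L (Suc i) j > 0"
    using label_pos_iff[of "Suc i" j] assms by auto
  have "L j (Suc i) = (if L i j \<noteq> L j i then L j i else L i (Suc j))"
    using symmetric[of "Suc i" "Suc j"] by (simp add: growth_label.simps(2))
  then show ?case using Suc pt
    by (auto simp: growth_label.simps(2)[of p i j] growth_label.simps(2)[of p "Suc i" j])
qed simp

lemma label_ascent_iff:
  assumes "Suc i < N"
  shows "p (Suc i) < p (Suc (Suc i)) \<longleftrightarrow> L (Suc i) N \<le> L i N"
proof -
  have "L i N > 0" using label_pos_iff le_N assms by simp
  then show ?thesis using ascent_label[of i N] descent_label[of i N] inj[of "Suc i" "Suc (Suc i)"]
    by (metis n_not_Suc_n not_le nat_neq_iff less_irrefl)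
qed

end

text \<open>By symmetry the top row also gives the right boundary, so the inverse local rule
  recovers all labels cell by cell, and \<open>label_pos_iff\<close> reads off the
  permutation.\<close>

lemma growth_label_inj:
  assumes "involution_on N p" "involution_on N q"
    and eq: "\<And>i. i < N \<Longrightarrow> growth_label p i N = growth_label q i N"
  shows "p = q"
proof -
  interpret P: involution_on N p by fact
  interpret Q: involution_on N q by fact
  have lab: "growth_label p i j = growth_label q i j" if "i < N" "j \<le> N" for i j
    using that
  proof (induction "2 * N - (i + j)" arbitrary: i j rule: less_induct)
    case less
    show ?case
    proof (cases "j = N")
      case True
      then show ?thesis using eq less.prems by simp
    next
      case False
      then have "growth_label p i (Suc j) = growth_label q i (Suc j)"
        "growth_label p j (Suc i) = growth_label q j (Suc i)"
        using less by auto
      then show ?thesis using P.label_step_back[of i j] Q.label_step_back[of i j] by simp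
    qed
  qed
  have "p k = q k" for k
  proof (cases "k \<in> {1..N}")
    case True
    then obtain i where i: "k = Suc i" "i < N" by (cases k) auto
    have "p k \<le> j \<longleftrightarrow> q k \<le> j" if "j \<le> N" for j
      using P.label_pos_iff[of i j] Q.label_pos_iff[of i j] lab[of i j] i that by simp
    then show ?thesis using P.le_N[of i] Q.le_N[of i] i by (metis le_antisym order_refl)
  next
    case False
    then show ?thesis using P.permutes Q.permutes by (simp add: permutes_not_in)
  qed
  then show ?thesis by blast
qed

text \<open>A standard tableau is encoded by the list of the rows of its entries; every prefix must
  have a partition as its shape.\<close>

definition lattice_word :: "nat list \<Rightarrow> bool" where
  "lattice_word ws \<longleftrightarrow> 0 \<notin> set ws \<and>
    (\<forall>k\<le>length ws. \<forall>r>0. count_list (take k ws) (Suc r) \<le> count_list (take k ws) r)"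

definition growth_word :: "nat \<Rightarrow> (nat \<Rightarrow> nat) \<Rightarrow> nat list" where
  "growth_word N p = map (\<lambda>i. growth_label p i N) [0..<N]"

lemma count_list_map_upt:
  "count_list (map f [0..<k]) r = card {i. i < k \<and> f i = r}"
proof (induction k)
  case (Suc k)
  have "{i. i < Suc k \<and> f i = r} =
      (if f k = r then insert k {i. i < k \<and> f i = r} else {i. i < k \<and> f i = r})"
    by (auto simp: less_Suc_eq)
  then show ?case using Suc by simp
qed simp

lemma count_list_growth_word:
  "k \<le> N \<Longrightarrow> count_list (take k (growth_word N p)) r = label_count p r k N"
  by (simp add: growth_word_def take_map take_upt count_list_map_upt label_count_def)

lemma (in involution_on) lattice_growth_word: "lattice_word (growth_word N p)"
  unfolding lattice_word_def
proof (intro conjI allI impI)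
  show "0 \<notin> set (growth_word N p)"
  proof
    assume "0 \<in> set (growth_word N p)"
    then obtain i where "i < N" "L i N = 0" by (auto simp: growth_word_def)
    then show False using label_pos_iff[of i N] le_N[of i] by simp
  qed
next
  fix k r :: nat assume "k \<le> length (growth_word N p)" "r > 0"
  moreover have "length (growth_word N p) = N" by (simp add: growth_word_def)
  ultimately show "count_list (take k (growth_word N p)) (Suc r) \<le> count_list (take k (growth_word N p)) r"
    using label_count_antitone by (simp add: count_list_growth_word)
qed

section \<open>Surjectivity: every lattice word is the top row of a growth\<close>

text \<open>The growth read backwards from its last row, with both coordinates measured from the far end.\<close>

function back_label :: "nat list \<Rightarrow> nat \<Rightarrow> nat \<Rightarrow> nat" where
  "back_label ws u 0 = rev ws ! u"
| "back_label ws u (Suc v) =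
    (if back_label ws u v = back_label ws v u then back_label ws u v - 1 else back_label ws u v)"
  by pat_completeness auto
termination by (relation "measure (\<lambda>(ws, u, v). u + v)") auto

declare back_label.simps(2) [simp del]

context
  fixes ws :: "nat list"
  assumes lattice: "lattice_word ws"
begin

text \<open>The \<open>r\<close>-th part of the partition at a vertex, defined by removing boxes along a path from the far corner.\<close>

definition back_part :: "nat \<Rightarrow> nat \<Rightarrow> nat \<Rightarrow> int" where
  "back_part r u v = int (count_list ws r) - (\<Sum>u'<u. of_bool (back_label ws u' 0 = r)) - (\<Sum>v'<v. of_bool (back_label ws v' u = r))"

lemma back_part_Suc_right: "back_part r u (Suc v) = back_part r u v - of_bool (back_label ws v u = r)"
  by (simp add: back_part_def)

text \<open>Path independence for the inverse rule: both routes around a cell remove the same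
  boxes.\<close>

lemma back_part_Suc_left:
  assumes "r > 0"
  shows "back_part r (Suc u) v = back_part r u v - of_bool (back_label ws u v = r)"
proof (induction v)
  case 0
  then show ?case by (simp add: back_part_def)
next
  case (Suc v)
  have "of_bool (back_label ws u (Suc v) = r) + of_bool (back_label ws v u = r) =
      (of_bool (back_label ws u v = r) + of_bool (back_label ws v (Suc u) = r) :: int)"
    using assms by (auto simp: back_label.simps(2))
  then show ?case using Suc by (simp add: back_part_Suc_right)
qed

lemma back_part_top:
  assumes "u \<le> length ws"
  shows "back_part r u 0 = int (count_list (take (length ws - u) ws) r)"
  using assms
proof (induction u)
  case 0
  then show ?case by (simp add: back_part_def)
next
  case (Suc u)
  have "take (length ws - u) ws = take (length ws - Suc u) ws @ [ws ! (length ws - Suc u)]"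
    using Suc.prems by (metis Suc_diff_Suc Suc_le_lessD diff_less less_le_trans take_Suc_conv_app_nth zero_less_Suc not_less_zero gr0I)
  moreover have "rev ws ! u = ws ! (length ws - Suc u)" using Suc.prems by (simp add: rev_nth)
  moreover have "back_part r (Suc u) 0 = back_part r u 0 - of_bool (back_label ws u 0 = r)"
    by (simp add: back_part_def)
  ultimately show ?case using Suc by simp
qed

lemma back_part_left: "back_part r 0 v = back_part r v 0"
  by (simp add: back_part_def)

text \<open>On the two outer lines the shapes are those of prefixes of \<open>ws\<close>, where the
  lattice condition applies. Inside, equal labels \<open>s\<close> lead to a further removal in row
  \<open>s - 1\<close>, which is safe because row \<open>s\<close> has just shrunk.\<close>

lemma back_part_antitone:
  assumes "r > 0" "u \<le> length ws" "v \<le> length ws"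
  shows "back_part (Suc r) u v \<le> back_part r u v"
  using assms
proof (induction "u + v" arbitrary: u v r rule: less_induct)
  case less
  have top: "back_part (Suc r) w 0 \<le> back_part r w 0" if "w \<le> length ws" for w
    using lattice less.prems(1) that by (simp add: back_part_top lattice_word_def)
  show ?case
  proof (cases "u = 0 \<or> v = 0")
    case True
    then show ?thesis using top less.prems by (auto simp: back_part_left)
  next
    case False
    then obtain u' v' where uv: "u = Suc u'" "v = Suc v'" by (metis not0_implies_Suc)
    define a b where "a = back_label ws u' v'" and "b = back_label ws v' u'"
    have IH: "back_part (Suc s) u' v' \<le> back_part s u' v'"
      "back_part (Suc s) (Suc u') v' \<le> back_part s (Suc u') v'"
      "back_part (Suc s) u' (Suc v') \<le> back_part s u' (Suc v')" if "s > 0" for s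
      using less.hyps[of _ _ s] that less.prems uv by auto
    have c1: "back_part s (Suc u') v' = back_part s u' v' - of_bool (a = s)" if "s > 0" for s
      using that by (simp add: back_part_Suc_left a_def)
    have c2: "back_part s u' (Suc v') = back_part s u' v' - of_bool (b = s)" for s
      by (simp add: back_part_Suc_right b_def)
    have c3: "back_part s (Suc u') (Suc v') = back_part s u' (Suc v') - of_bool (back_label ws u' (Suc v') = s)"
      if "s > 0" for s
      using that by (simp add: back_part_Suc_left)
    have L: "back_label ws u' (Suc v') = (if a = b then a - 1 else a)"
      by (simp add: back_label.simps(2) a_def b_def)
    show ?thesis
      using IH(1)[of r] IH(2)[of r] IH(3)[of r] less.prems c1[of r] c1[of "Suc r"] c2[of r]
        c2[of "Suc r"] c3[of r] c3[of "Suc r"] unfolding uv L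
      by (auto split: if_splits simp: of_bool_def)
  qed
qed

lemma back_label_le: "u < length ws \<Longrightarrow> back_label ws u v \<le> Max (set ws)"
proof (induction v)
  case 0
  then have "rev ws ! u \<in> set ws" by (metis length_rev nth_mem set_rev)
  then show ?case by simp
next
  case (Suc v)
  then have "back_label ws u v \<le> Max (set ws)" by simp
  then show ?case by (simp add: back_label.simps(2) le_diff_conv le_trans[OF diff_le_self])
qed

text \<open>Rows beyond the largest letter are empty and the parts decrease weakly, so no part is
  negative.\<close>

lemma back_part_nonneg:
  assumes "r > 0" "u \<le> length ws" "v \<le> length ws"
  shows "back_part r u v \<ge> 0"
proof (cases "r \<le> Max (set ws)")
  case le: False
  have "back_part r u v = 0"
  proof -
    have "count_list ws r = 0" using le by (auto simp: count_list_0_iff)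
    moreover have "back_label ws u' 0 \<noteq> r" if "u' < u" for u'
      using back_label_le[of u' 0] that assms le by auto
    moreover have "back_label ws v' u \<noteq> r" if "v' < v" for v'
      using back_label_le[of v' u] that assms le by auto
    ultimately show ?thesis by (simp add: back_part_def)
  qed
  then show ?thesis by simp
next
  case True
  define M where "M = Max (set ws)"
  have "count_list ws (Suc M) = 0"
    unfolding M_def count_list_0_iff by (metis List.finite_set Max_ge not_less_eq_eq order_refl)
  moreover have "back_label ws u' 0 \<noteq> Suc M" if "u' < u" for u'
    using back_label_le[of u' 0] that assms M_def by auto
  moreover have "back_label ws v' u \<noteq> Suc M" if "v' < v" for v'
    using back_label_le[of v' u] that assms M_def by auto
  ultimately have "back_part (Suc M) u v = 0" by (simp add: back_part_def)
  moreover have "back_part (Suc M) u v \<le> back_part r u v" if "r \<le> Suc M" 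
    using that
  proof (induction rule: inc_induct)
    case (step n)
    then show ?case using back_part_antitone[of n u v] assms by linarith
  qed simp
  ultimately show ?thesis using True M_def by simp
qed

text \<open>On the line \<open>u = length ws\<close> the shape starts out empty, so removing a box
  there would make a part negative.\<close>

lemma back_label_boundary:
  assumes "u < length ws"
  shows "back_label ws u (length ws) = 0"
proof (rule ccontr)
  define r where "r = back_label ws u (length ws)"
  assume "back_label ws u (length ws) \<noteq> 0"
  then have r: "r > 0" by (simp add: r_def)
  have "back_part r (length ws) (Suc u) = back_part r (length ws) 0 - (\<Sum>v'<Suc u. of_bool (back_label ws v' (length ws) = r))"
    by (simp add: back_part_def)
  also have "back_part r (length ws) 0 = 0" by (simp add: back_part_top)
  also have "(\<Sum>v'<Suc u. of_bool (back_label ws v' (length ws) = r)) \<ge> (1::int)"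
    by (simp add: r_def sum_nonneg)
  then have "0 - (\<Sum>v'<Suc u. of_bool (back_label ws v' (length ws) = r)) < (0::int)" by linarith
  finally show False using back_part_nonneg[OF r, of "length ws" "Suc u"] assms by simp
qed

end

lemma ex_growth_word:
  assumes "lattice_word ws"
  obtains p where "involution_on (length ws) p" "growth_word (length ws) p = ws"
proof -
  define N where "N = length ws"
  \<comment> \<open>Back to forward coordinates; the inverse growth becomes the candidate for
    \<open>growth_label\<close>.\<close>
  define B where "B i j = back_label ws (N - 1 - i) (N - j)" for i j
  have top: "B i N = ws ! i" if "i < N" for i
    using that by (simp add: B_def rev_nth N_def)
  have pos: "B i N > 0" if "i < N" for i
    using assms that by (metis N_def lattice_word_def nth_mem top gr0I)
  have bottom: "B i 0 = 0" if "i < N" for i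
    using back_label_boundary[OF assms] that by (simp add: B_def N_def)
  have step: "B i j = (if B i (Suc j) = B j (Suc i) then B i (Suc j) - 1 else B i (Suc j))"
    if "i < N" "j < N" for i j
  proof -
    have "B i j = back_label ws (N - 1 - i) (Suc (N - 1 - j))"
      using that by (simp add: B_def Suc_diff_Suc)
    then show ?thesis by (simp add: B_def back_label.simps(2))
  qed
  have le: "B i j \<le> B i (Suc j)" if "i < N" "j < N" for i j
    using step[OF that] by simp
  have mono: "B i j \<le> B i k" if "i < N" "j \<le> k" "k \<le> N" for i j k
    using that(2,3)
  proof (induction rule: dec_induct)
    case (step n)
    then show ?case using le[of i n] that(1) by simp
  qed simp
  \<comment> \<open>The point of column \<open>i\<close> must lie in the cell where the label
    becomes positive, by \<open>label_pos_iff\<close>.\<close>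
  define q where "q i = (LEAST j. B i (Suc j) > 0)" for i
  have q: "q i < N" "B i (Suc (q i)) > 0" "B i (q i) = 0" if i: "i < N" for i
  proof -
    have ex: "B i (Suc (N - 1)) > 0" using pos[OF i] i by simp
    then have "q i \<le> N - 1" unfolding q_def by (rule Least_le)
    then show "q i < N" using i by simp
    show "B i (Suc (q i)) > 0" unfolding q_def using ex by (rule LeastI)
    show "B i (q i) = 0"
    proof (cases "q i")
      case 0
      then show ?thesis using bottom i by simp
    next
      case (Suc k)
      then show ?thesis using not_less_Least[of k "\<lambda>j. B i (Suc j) > 0"] unfolding q_def by simp
    qed
  qed
  have q_eq: "q i = j \<longleftrightarrow> B i j = 0 \<and> B i (Suc j) > 0" if "i < N" "j < N" for i j
  proof
    assume *: "B i j = 0 \<and> B i (Suc j) > 0"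
    show "q i = j"
    proof (rule ccontr)
      assume "q i \<noteq> j"
      then consider "Suc (q i) \<le> j" | "Suc j \<le> q i" by linarith
      then show False
        using mono[of i "Suc (q i)" j] mono[of i "Suc j" "q i"] q[of i] * that by cases auto
    qed
  qed (use q that in auto)
  \<comment> \<open>Going backwards, a positive label reaches \<open>0\<close> only from
    \<open>1\<close> and only against an equal crossing label. This condition is symmetric in
    \<open>i\<close> and \<open>j\<close>, so \<open>q\<close> is an involution.\<close>
  have point: "B i (Suc j) = 1 \<and> B j (Suc i) = 1" if "i < N" "j < N" "q i = j" for i j
  proof -
    have "B i j = 0" "B i (Suc j) > 0" using q_eq[of i j] that by auto
    then show ?thesis using step[OF that(1,2)] by (simp split: if_splits)
  qed
  have q_iff: "q i = j \<longleftrightarrow> B i (Suc j) = 1 \<and> B j (Suc i) = 1" if "i < N" "j < N" for i j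
  proof
    assume "B i (Suc j) = 1 \<and> B j (Suc i) = 1"
    then show "q i = j" using q_eq[OF that] step[OF that] by simp
  qed (use point[OF that] in simp)
  have q_sym: "q (q i) = i" if "i < N" for i
    using q_iff[of i "q i"] q_iff[of "q i" i] q(1) that by auto
  define p where "p k = (if k \<in> {1..N} then Suc (q (k - 1)) else k)" for k
  have invol: "p (p k) = k" for k
  proof (cases "k \<in> {1..N}")
    case True
    then have "k - 1 < N" by auto
    then show ?thesis using True q_sym[of "k - 1"] q(1)[of "k - 1"] by (auto simp: p_def Suc_le_eq)
  qed (auto simp: p_def)
  have "p permutes {1..N}"
    unfolding permutes_def
  proof (intro conjI allI impI)
    fix y
    show "\<exists>!x. p x = y" using invol by metis
  qed (auto simp: p_def)
  then have P: "involution_on N p" using invol by unfold_locales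
  have pq: "p (Suc i) = Suc j \<longleftrightarrow> q i = j" if "i < N" for i j
    using that by (simp add: p_def)
  have "growth_label p i j = B i j" if "i < N" "j \<le> N" for i j
    using that
  proof (induction "i + j" arbitrary: i j rule: less_induct)
    case less
    show ?case
    proof (cases j)
      case 0
      then show ?thesis using bottom less.prems by simp
    next
      case (Suc k)
      then have IH: "growth_label p i k = B i k" "growth_label p k i = B k i" and "k < N"
        using less by auto
      show ?thesis
        using step[OF less.prems(1) \<open>k < N\<close>] step[OF \<open>k < N\<close> less.prems(1)]
          q_iff[OF less.prems(1) \<open>k < N\<close>] pq[OF less.prems(1), of k]
        unfolding Suc growth_label.simps(2) IH
        by (cases "B i (Suc k) = B k (Suc i)") (auto simp del: growth_label.simps)
    qed
  qed
  then have "growth_word N p = ws"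
    by (intro nth_equalityI) (auto simp: growth_word_def top[unfolded N_def] N_def)
  then show ?thesis using that[of p] P by (simp add: N_def)
qed

subsection \<open>Motzkin paths and alternating tableaux with three columns\<close>

definition motzkin_from :: "nat \<Rightarrow> nat \<Rightarrow> nat" where
  "motzkin_from n h = card {xs. length xs = n \<and>
     (\<forall>k\<le>n. int h + height_after k xs \<ge> 0) \<and> int h + height_after n xs = 0}"

lemma motzkin_from_0: "motzkin_from n 0 = motzkin (int n)"
  by (simp add: motzkin_from_def motzkin_def motzkin_paths_def)

lemma height_after_0 [simp]: "height_after 0 xs = 0"
  by (simp add: height_after_def)

lemma height_after_Cons [simp]: "height_after (Suc k) (s # xs) = rise s + height_after k xs"
  by (simp add: height_after_def)

lemma finite_steps: "finite {xs :: motzkin_step list. length xs = n \<and> P xs}"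
proof -
  have "(UNIV :: motzkin_step set) = {Up, Down, Level}" using motzkin_step.exhaust by auto
  then have "finite (UNIV :: motzkin_step set)" by (metis finite.emptyI finite.insertI)
  then show ?thesis
    by (intro finite_subset[OF _ finite_lists_length_eq[of UNIV n]]) auto
qed

lemma motzkin_from_zero: "motzkin_from 0 h = of_bool (h = 0)"
proof -
  have "{xs :: motzkin_step list. length xs = 0 \<and> (\<forall>k\<le>0. int h + height_after k xs \<ge> 0) \<and>
      int h + height_after 0 xs = 0} = (if h = 0 then {[]} else {})"
    by auto
  then show ?thesis by (simp add: motzkin_from_def)
qed

lemma motzkin_from_Suc:
  "motzkin_from (Suc n) h =
    (if h = 0 then 0 else motzkin_from n (h - 1)) + motzkin_from n h + motzkin_from n (Suc h)"
proof -
  define A where "A m k = {xs. length xs = m \<and>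
     (\<forall>i\<le>m. k + height_after i xs \<ge> 0) \<and> k + height_after m xs = 0}" for m and k :: int
  have fin: "finite (A m k)" for m k unfolding A_def by (rule finite_steps)
  \<comment> \<open>This takes care of a \<open>Down\<close> step at height
    \<open>0\<close>.\<close>
  have neg: "A m k = {}" if "k < 0" for m k
    using that by (force simp: A_def)
  have Cons: "s # xs \<in> A (Suc m) k \<longleftrightarrow> k \<ge> 0 \<and> xs \<in> A m (k + rise s)" for s xs m k
  proof -
    have "(\<forall>i\<le>Suc m. k + height_after i (s # xs) \<ge> 0) \<longleftrightarrow>
        k \<ge> 0 \<and> (\<forall>i\<le>m. k + rise s + height_after i xs \<ge> 0)"
      unfolding atMost_iff[symmetric] Ball_def[symmetric] atMost_Suc_eq_insert_0
      by (simp add: add.assoc)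
    then show ?thesis by (auto simp: A_def add.assoc)
  qed
  have "A (Suc n) (int h) = Cons Up ` A n (int h + 1) \<union> (Cons Down ` A n (int h - 1) \<union> Cons Level ` A n (int h))"
  proof (intro equalityI subsetI)
    fix xs assume *: "xs \<in> A (Suc n) (int h)"
    then obtain s ys where xs: "xs = s # ys" by (auto simp: A_def length_Suc_conv)
    then show "xs \<in> Cons Up ` A n (int h + 1) \<union> (Cons Down ` A n (int h - 1) \<union> Cons Level ` A n (int h))"
      using * by (cases s) (auto simp: Cons)
  qed (auto simp: Cons)
  then have "card (A (Suc n) (int h)) = card (A n (int h + 1)) + (card (A n (int h - 1)) + card (A n (int h)))"
    by (simp only:) (subst card_Un_disjoint, auto simp: fin card_image, subst card_Un_disjoint, auto simp: fin card_image)
  moreover have "A n (int h - 1) = (case h of 0 \<Rightarrow> {} | Suc k \<Rightarrow> A n (int k))"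
    using neg[of "- 1" n] by (cases h) simp_all
  moreover have card: "motzkin_from m k = card (A m (int k))" for m k
    by (simp add: motzkin_from_def A_def)
  ultimately show ?thesis
    unfolding card by (cases h) (simp_all add: algebra_simps)
qed

text \<open>Used with \<open>x = Suc (a - b)\<close> and \<open>y = Suc (b - c)\<close>; an empty
  range of summation then removes the term of an impossible pair of columns.\<close>

definition motzkin_rect :: "nat \<Rightarrow> nat \<Rightarrow> nat \<Rightarrow> nat" where
  "motzkin_rect n x y = (\<Sum>i<x. \<Sum>j<y. motzkin_from n (i + j))"

text \<open>The summands belong to pairs of boxes in columns 1 and 2, 1 and 3, 2 and 3. Split by the
  first step: \<open>Down\<close> gives the third rectangle and a leftover row; this row and the
  \<open>Up\<close> terms with \<open>j < y\<close> form the second; the \<open>Up\<close> terms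
  with \<open>j = y\<close> widen the \<open>Level\<close> rectangle to the first.\<close>

lemma motzkin_rect_Suc:
  "motzkin_rect (Suc n) (Suc x) (Suc y) =
    motzkin_rect n (Suc x) (Suc (Suc y)) + motzkin_rect n (Suc (Suc x)) y + motzkin_rect n x (Suc y)"
proof -
  let ?m = "motzkin_from n"
  let ?d = "\<lambda>h. if h = 0 then 0 else ?m (h - 1)"
  have shift: "(\<Sum>i<Suc k. g i) = g 0 + (\<Sum>i<k. g (Suc i))" for g :: "nat \<Rightarrow> nat" and k
    by (rule sum.lessThan_Suc_shift)
  have 1: "motzkin_rect (Suc n) (Suc x) (Suc y) =
      (\<Sum>i<Suc x. \<Sum>j<Suc y. ?d (i + j)) + motzkin_rect n (Suc x) (Suc y)
        + (\<Sum>i<Suc x. \<Sum>j<Suc y. ?m (Suc (i + j)))"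
    by (simp only: motzkin_rect_def motzkin_from_Suc sum.distrib)
  have 2: "(\<Sum>i<Suc x. \<Sum>j<Suc y. ?d (i + j)) =
      (\<Sum>j<Suc y. ?d j) + motzkin_rect n x (Suc y)"
    unfolding motzkin_rect_def by (rule trans[OF shift]) (simp only: add_0 add_Suc nat.simps diff_Suc_1 if_False)
  have 3: "(\<Sum>j<Suc y. ?d j) = (\<Sum>j<y. ?m j)"
    by (rule trans[OF shift]) (simp del: sum.lessThan_Suc)
  have 4: "(\<Sum>i<Suc x. \<Sum>j<Suc y. ?m (Suc (i + j))) =
      (\<Sum>i<Suc x. \<Sum>j<y. ?m (Suc (i + j))) + (\<Sum>i<Suc x. ?m (Suc (i + y)))"
    by (simp only: sum.lessThan_Suc sum.distrib)
  have 5: "motzkin_rect n (Suc (Suc x)) y =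
      (\<Sum>j<y. ?m j) + (\<Sum>i<Suc x. \<Sum>j<y. ?m (Suc (i + j)))"
    unfolding motzkin_rect_def by (rule trans[OF shift]) (simp del: sum.lessThan_Suc)
  have 6: "motzkin_rect n (Suc x) (Suc (Suc y)) =
      motzkin_rect n (Suc x) (Suc y) + (\<Sum>i<Suc x. ?m (Suc (i + y)))"
    unfolding motzkin_rect_def sum.distrib[symmetric] by (intro sum.cong) auto
  show ?thesis using 1 2 3 4 5 6 by linarith
qed

section \<open>Words of alternating tableaux with at most three columns\<close>

definition alternating_word :: "nat list \<Rightarrow> bool" where
  "alternating_word ws \<longleftrightarrow> (\<forall>i. Suc i < length ws \<longrightarrow> (ws ! Suc i \<le> ws ! i \<longleftrightarrow> even i))"

definition three_column_word :: "nat list \<Rightarrow> bool" where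
  "three_column_word ws \<longleftrightarrow> lattice_word ws \<and> count_list ws 1 \<le> 3"

text \<open>The tableau of the lattice word \<open>ws\<close> has columns of heights \<open>a\<close>, \<open>b\<close> and \<open>c\<close>.\<close>

definition column_heights :: "nat list \<Rightarrow> nat \<Rightarrow> nat \<Rightarrow> nat \<Rightarrow> bool" where
  "column_heights ws a b c \<longleftrightarrow> c \<le> b \<and> b \<le> a \<and>
    (\<forall>r>0. count_list ws r = of_bool (r \<le> a) + of_bool (r \<le> b) + of_bool (r \<le> c))"

lemma lattice_word_snoc:
  "lattice_word (ws @ [r]) \<longleftrightarrow>
    lattice_word ws \<and> r > 0 \<and> (r = 1 \<or> count_list ws r < count_list ws (r - 1))"
proof -
  have "lattice_word (ws @ [r]) \<longleftrightarrow> lattice_word ws \<and> r > 0 \<and>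
      (\<forall>s>0. count_list (ws @ [r]) (Suc s) \<le> count_list (ws @ [r]) s)"
    by (auto simp: lattice_word_def le_Suc_eq all_conj_distrib)
  also have "\<dots> \<longleftrightarrow> lattice_word ws \<and> r > 0 \<and> (r = 1 \<or> count_list ws r < count_list ws (r - 1))"
  proof (cases "lattice_word ws \<and> r > 0")
    case True
    then have le: "count_list ws (Suc s) \<le> count_list ws s" if "s > 0" for s
      using that by (auto simp: lattice_word_def dest: spec[of _ "length ws"])
    have "(\<forall>s>0. count_list (ws @ [r]) (Suc s) \<le> count_list (ws @ [r]) s) \<longleftrightarrow>
        (r = 1 \<or> count_list ws r < count_list ws (r - 1))"
    proof
      assume *: "\<forall>s>0. count_list (ws @ [r]) (Suc s) \<le> count_list (ws @ [r]) s"
      show "r = 1 \<or> count_list ws r < count_list ws (r - 1)"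
      proof (cases "r = 1")
        case False
        then obtain s where "r = Suc s" "s > 0" using True by (cases r) auto
        then show ?thesis using *[rule_format, of s] by simp
      qed simp
    next
      assume "r = 1 \<or> count_list ws r < count_list ws (r - 1)"
      then show "\<forall>s>0. count_list (ws @ [r]) (Suc s) \<le> count_list (ws @ [r]) s"
        using le by (auto simp: le_Suc_eq Suc_le_eq)
    qed
    then show ?thesis using True by simp
  qed auto
  finally show ?thesis .
qed

text \<open>A new box contributes the letter one above the old height of its column; the bound on
  the letter \<open>1\<close> excludes a fourth column.\<close>

lemma three_column_snoc:
  assumes "three_column_word ws" "column_heights ws a b c"
  shows "three_column_word (ws @ [r]) \<longleftrightarrow> r = Suc a \<or> (r = Suc b \<and> b < a) \<or> (r = Suc c \<and> c < b)"
proof -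
  have cnt: "count_list ws s = of_bool (s \<le> a) + of_bool (s \<le> b) + of_bool (s \<le> c)" if "s > 0" for s
    using assms(2) that by (simp add: column_heights_def)
  have le: "c \<le> b" "b \<le> a" using assms(2) by (auto simp: column_heights_def)
  have "three_column_word (ws @ [r]) \<longleftrightarrow> r > 0 \<and> (r = 1 \<or> count_list ws r < count_list ws (r - 1))
      \<and> count_list ws 1 + of_bool (r = 1) \<le> 3"
    using assms(1) by (auto simp: three_column_word_def lattice_word_snoc)
  also have "\<dots> \<longleftrightarrow> r = Suc a \<or> (r = Suc b \<and> b < a) \<or> (r = Suc c \<and> c < b)"
  proof (cases "r \<le> 1")
    case True
    then show ?thesis using le cnt[of 1] by (cases "r = 0") (auto simp: of_bool_def)
  next
    case False
    then show ?thesis using le cnt[of 1] cnt[of r] cnt[of "r - 1"] by (auto simp: of_bool_def)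
  qed
  finally show ?thesis .
qed

lemma column_heights_snoc:
  assumes "column_heights ws a b c"
  shows "column_heights (ws @ [Suc a]) (Suc a) b c"
    and "b < a \<Longrightarrow> column_heights (ws @ [Suc b]) a (Suc b) c"
    and "c < b \<Longrightarrow> column_heights (ws @ [Suc c]) a b (Suc c)"
  using assms by (auto simp: column_heights_def of_bool_def)

lemma alternating_word_snoc:
  assumes "ws \<noteq> []"
  shows "alternating_word (ws @ [r]) \<longleftrightarrow> alternating_word ws \<and> (r \<le> last ws \<longleftrightarrow> odd (length ws))"
proof -
  obtain k where k: "length ws = Suc k" using assms by (cases "length ws") auto
  have "alternating_word (ws @ [r]) \<longleftrightarrow>
      (\<forall>i. Suc i < length ws \<longrightarrow> (ws ! Suc i \<le> ws ! i \<longleftrightarrow> even i)) \<and> (r \<le> ws ! k \<longleftrightarrow> even k)"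
    unfolding alternating_word_def using k by (auto simp: nth_append less_Suc_eq)
  then show ?thesis using k by (simp add: alternating_word_def last_conv_nth assms)
qed

definition good_word :: "nat list \<Rightarrow> bool" where
  "good_word ws \<longleftrightarrow> three_column_word ws \<and> alternating_word ws"

section \<open>Counting completions, two letters at a time\<close>

definition completions :: "nat \<Rightarrow> nat list \<Rightarrow> nat list set" where
  "completions n ws = {vs. length vs = n \<and> good_word (ws @ vs)}"

lemma good_word_Nil: "good_word []"
  by (simp add: good_word_def three_column_word_def lattice_word_def alternating_word_def)

lemma good_word_snocD: "good_word (ws @ [r]) \<Longrightarrow> good_word ws"
proof (cases "ws = []")
  case False
  then show "good_word (ws @ [r]) \<Longrightarrow> good_word ws"
    by (auto simp: good_word_def three_column_word_def lattice_word_snoc alternating_word_snoc)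
qed (simp add: good_word_Nil)

lemma good_word_append: "good_word (ws @ vs) \<Longrightarrow> good_word ws"
proof (induction vs rule: rev_induct)
  case (snoc v vs)
  then show ?case using good_word_snocD[of "ws @ vs" v] by simp
qed simp

lemma completions_Suc:
  "completions (Suc n) ws = (\<Union>r\<in>{r. good_word (ws @ [r])}. Cons r ` completions n (ws @ [r]))"
proof (intro equalityI subsetI)
  fix vs assume *: "vs \<in> completions (Suc n) ws"
  then obtain r us where vs: "vs = r # us" by (auto simp: completions_def length_Suc_conv)
  with * have "good_word ((ws @ [r]) @ us)" "length us = n" by (auto simp: completions_def)
  then show "vs \<in> (\<Union>r\<in>{r. good_word (ws @ [r])}. Cons r ` completions n (ws @ [r]))"
    using good_word_append[of "ws @ [r]" us] vs by (auto simp: completions_def)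
qed (auto simp: completions_def)

lemma completions_0: "good_word ws \<Longrightarrow> completions 0 ws = {[]}"
  by (auto simp: completions_def)

lemma next_letters:
  assumes "good_word ws" "column_heights ws a b c"
  shows "{r. good_word (ws @ [r])} =
    {r. (r = Suc a \<or> (r = Suc b \<and> b < a) \<or> (r = Suc c \<and> c < b)) \<and>
        (ws = [] \<or> (r \<le> last ws \<longleftrightarrow> odd (length ws)))}"
  using assms three_column_snoc[of ws a b c] alternating_word_snoc[of ws]
  by (cases "ws = []") (auto simp: good_word_def alternating_word_def)

text \<open>State after an even number of letters: the last box does not lie in the first column.\<close>

definition even_state :: "nat list \<Rightarrow> nat \<Rightarrow> nat \<Rightarrow> nat \<Rightarrow> bool" where
  "even_state ws a b c \<longleftrightarrow> good_word ws \<and> column_heights ws a b c \<and> even (length ws) \<and>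
    (ws = [] \<or> last ws \<le> b)"

lemma finite_completions:
  "good_word ws \<Longrightarrow> column_heights ws a b c \<Longrightarrow> finite (completions n ws)"
proof (induction n arbitrary: ws a b c)
  case (Suc n)
  let ?R = "{r. good_word (ws @ [r])}"
  have "?R \<subseteq> {Suc a, Suc b, Suc c}" using next_letters[OF Suc.prems] by auto
  then have "finite ?R" by (rule finite_subset) simp
  moreover have "finite (completions n (ws @ [r]))" if "r \<in> ?R" for r
  proof -
    have "r = Suc a \<or> (r = Suc b \<and> b < a) \<or> (r = Suc c \<and> c < b)"
      using that next_letters[OF Suc.prems] by auto
    then obtain a' b' c' where "column_heights (ws @ [r]) a' b' c'"
      using column_heights_snoc[OF Suc.prems(2)] by blast
    then show ?thesis using Suc.IH that by blast
  qed
  ultimately show ?case by (simp add: completions_Suc)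
qed (simp add: completions_0)

lemma card_completions_Suc:
  assumes "good_word ws" "column_heights ws a b c"
  shows "card (completions (Suc n) ws) = (\<Sum>r | good_word (ws @ [r]). card (completions n (ws @ [r])))"
proof -
  let ?R = "{r. good_word (ws @ [r])}"
  have "?R \<subseteq> {Suc a, Suc b, Suc c}" using next_letters[OF assms] by auto
  then have fin: "finite ?R" by (rule finite_subset) simp
  have fin': "finite (completions n (ws @ [r]))" if "r \<in> ?R" for r
  proof -
    have "finite (Cons r ` completions n (ws @ [r]))"
      using finite_completions[OF assms, of "Suc n"] that
      by (elim finite_subset[rotated]) (auto simp: completions_Suc)
    then show ?thesis by (rule finite_imageD) simp
  qed
  show ?thesis
    unfolding completions_Suc
    by (subst card_UN_disjoint) (use fin fin' in \<open>auto simp: card_image\<close>)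
qed

text \<open>The first box of a pair lies strictly below the preceding box, the second weakly above
  the first and so further right. After a first box in column 3 all addable boxes are strictly
  lower, so only the three pairs of distinct columns remain.\<close>

lemma even_state_step:
  assumes "even_state ws a b c"
  shows "even_state (ws @ [Suc a, Suc b]) (Suc a) (Suc b) c"
    and "c < b \<Longrightarrow> even_state (ws @ [Suc a, Suc c]) (Suc a) b (Suc c)"
    and "b < a \<Longrightarrow> even_state (ws @ [Suc b, Suc c]) a (Suc b) (Suc c)"
    and "card (completions (Suc (Suc n)) ws) = card (completions n (ws @ [Suc a, Suc b]))
      + (if c < b then card (completions n (ws @ [Suc a, Suc c])) else 0)
      + (if b < a then card (completions n (ws @ [Suc b, Suc c])) else 0)"
proof -
  note st = assms[unfolded even_state_def]
  have good: "good_word ws" and ch: "column_heights ws a b c" using st by auto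
  have le: "c \<le> b" "b \<le> a" using ch by (auto simp: column_heights_def)
  \<comment> \<open>The bound \<open>last ws \<le> b\<close> keeps columns 1 and 2 open to the first
    box of a pair; only column 3 depends on the last letter.\<close>
  have R: "{r. good_word (ws @ [r])} =
      (if b < a then {Suc b} else {}) \<union> {Suc a} \<union> (if c < b \<and> (ws = [] \<or> last ws \<le> c) then {Suc c} else {})"
    unfolding next_letters[OF good ch] using st le by auto
  have R': "good_word (ws @ [r]) \<longleftrightarrow>
      (b < a \<and> r = Suc b) \<or> r = Suc a \<or> (c < b \<and> (ws = [] \<or> last ws \<le> c) \<and> r = Suc c)" for r
    using arg_cong[OF R, of "\<lambda>X. r \<in> X"] by (auto split: if_splits)
  note chs = column_heights_snoc[OF ch]
  have odd: "odd (length (ws @ [r]))" for r using st by simp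
  have R1: "{s. good_word ((ws @ [Suc a]) @ [s])} = {Suc b} \<union> (if c < b then {Suc c} else {})"
  proof -
    have "good_word (ws @ [Suc a])" by (simp add: R')
    note letters = next_letters[OF this chs(1)]
    show ?thesis unfolding letters using odd le by (auto simp del: append_assoc)
  qed
  have R2: "{s. good_word ((ws @ [Suc b]) @ [s])} = {Suc c}" if "b < a"
  proof -
    have "good_word (ws @ [Suc b])" using that by (simp add: R')
    note letters = next_letters[OF this chs(2)[OF that]]
    show ?thesis unfolding letters using odd le that by (auto simp del: append_assoc)
  qed
  have R3: "{s. good_word ((ws @ [Suc c]) @ [s])} = {}" if "c < b" "ws = [] \<or> last ws \<le> c"
  proof -
    have "good_word (ws @ [Suc c])" using that by (simp add: R')
    note letters = next_letters[OF this chs(3)[OF that(1)]]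
    show ?thesis unfolding letters using odd le that by (auto simp del: append_assoc)
  qed
  have g1: "good_word (ws @ [Suc a])" by (simp add: R')
  have g11: "good_word (ws @ [Suc a, Suc b])" using arg_cong[OF R1, of "\<lambda>X. Suc b \<in> X"] by simp
  have g12: "good_word (ws @ [Suc a, Suc c])" if "c < b"
    using arg_cong[OF R1, of "\<lambda>X. Suc c \<in> X"] that by simp
  have g2: "good_word (ws @ [Suc b])" if "b < a" using that by (simp add: R')
  have g21: "good_word (ws @ [Suc b, Suc c])" if "b < a"
    using arg_cong[OF R2[OF that], of "\<lambda>X. Suc c \<in> X"] by simp
  show "even_state (ws @ [Suc a, Suc b]) (Suc a) (Suc b) c"
    using g11 column_heights_snoc(2)[OF chs(1)] le st by (simp add: even_state_def)
  show "even_state (ws @ [Suc a, Suc c]) (Suc a) b (Suc c)" if "c < b"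
    using g12[OF that] column_heights_snoc(3)[OF chs(1)] that st by (simp add: even_state_def)
  show "even_state (ws @ [Suc b, Suc c]) a (Suc b) (Suc c)" if "b < a"
    using g21[OF that] column_heights_snoc(3)[OF chs(2)[OF that]] le st by (simp add: even_state_def)
  have 1: "card (completions (Suc n) (ws @ [Suc a])) = card (completions n (ws @ [Suc a, Suc b]))
      + (if c < b then card (completions n (ws @ [Suc a, Suc c])) else 0)"
    using card_completions_Suc[OF g1 chs(1), of n] unfolding R1 by auto
  have 2: "card (completions (Suc n) (ws @ [Suc b])) = card (completions n (ws @ [Suc b, Suc c]))" if "b < a"
    using card_completions_Suc[OF g2 chs(2), of n] that unfolding R2[OF that] by simp
  have 3: "card (completions (Suc n) (ws @ [Suc c])) = 0" if *: "c < b" "ws = [] \<or> last ws \<le> c"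
  proof -
    have "good_word (ws @ [Suc c])" using * by (simp add: R')
    from card_completions_Suc[OF this chs(3)[OF *(1)], of n] show ?thesis unfolding R3[OF *] by simp
  qed
  show "card (completions (Suc (Suc n)) ws) = card (completions n (ws @ [Suc a, Suc b]))
      + (if c < b then card (completions n (ws @ [Suc a, Suc c])) else 0)
      + (if b < a then card (completions n (ws @ [Suc b, Suc c])) else 0)"
    using card_completions_Suc[OF good ch, of "Suc n"] 1 2 3 le unfolding R by auto
qed

lemma motzkin_rect_0: "motzkin_rect 0 (Suc x) (Suc y) = 1"
proof -
  have "(\<Sum>j<Suc y. motzkin_from 0 (i + j)) = (if i = 0 then 1 else 0)" for i
    by (simp add: motzkin_from_zero sum.lessThan_Suc_shift del: sum.lessThan_Suc)
  then show ?thesis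
    by (simp add: motzkin_rect_def sum.lessThan_Suc_shift del: sum.lessThan_Suc)
qed

lemma motzkin_rect_empty [simp]: "motzkin_rect n 0 y = 0" "motzkin_rect n x 0 = 0"
  by (simp_all add: motzkin_rect_def)

lemma card_completions_even:
  "even_state ws a b c \<Longrightarrow> card (completions (2 * n) ws) = motzkin_rect n (Suc (a - b)) (Suc (b - c))"
proof (induction n arbitrary: ws a b c)
  case 0
  then show ?case by (simp add: completions_0 motzkin_rect_0 even_state_def)
next
  case (Suc n)
  note step = even_state_step[OF Suc.prems]
  have "c \<le> b" "b \<le> a" using Suc.prems by (auto simp: even_state_def column_heights_def)
  then obtain x y where xy: "b = c + y" "a = c + y + x" by (metis le_iff_add)
  show ?case
    using step(4)[of "2 * n"] Suc.IH[OF step(1)] Suc.IH[OF step(2)] Suc.IH[OF step(3)]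
    by (cases x; cases y) (auto simp: xy motzkin_rect_Suc)
qed

text \<open>A single last box has as many places as a pair, except that column 3 is closed after a
  pair in columns 1 and 2. The correction counts completions by \<open>n\<close> pairs ending that
  way: such a pair always fits, so it can follow any \<open>n - 1\<close> pairs. For
  \<open>n = 0\<close> the word \<open>ws\<close> itself decides.\<close>

lemma card_completions_odd:
  "even_state ws a b c \<Longrightarrow> card (completions (2 * n + 1) ws) +
      (case n of 0 \<Rightarrow> of_bool (ws \<noteq> [] \<and> last ws > c) | Suc m \<Rightarrow> motzkin_rect m (Suc (a - b)) (Suc (b - c)))
    = motzkin_rect (Suc n) (Suc (a - b)) (Suc (b - c))"
proof (induction n arbitrary: ws a b c)
  case 0
  then have good: "good_word ws" and ch: "column_heights ws a b c" by (auto simp: even_state_def)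
  have le: "c \<le> b" "b \<le> a" using ch by (auto simp: column_heights_def)
  then obtain x y where xy: "b = c + y" "a = c + y + x" by (metis le_iff_add)
  have R: "{r. good_word (ws @ [r])} =
      (if b < a then {Suc b} else {}) \<union> {Suc a} \<union> (if c < b \<and> (ws = [] \<or> last ws \<le> c) then {Suc c} else {})"
    unfolding next_letters[OF good ch] using 0 le by (auto simp: even_state_def)
  have "card (completions 1 ws) = (\<Sum>r | good_word (ws @ [r]). 1)"
    using card_completions_Suc[OF good ch, of 0] by (simp add: completions_0)
  also have "\<dots> = 1 + of_bool (b < a) + of_bool (c < b \<and> (ws = [] \<or> last ws \<le> c))"
    unfolding R using le by auto
  finally show ?case
    using 0 by (cases x; cases y) (auto simp: xy motzkin_rect_Suc motzkin_rect_0 even_state_def)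
next
  case (Suc n)
  note step = even_state_step[OF Suc.prems]
  have le: "c \<le> b" "b \<le> a" using Suc.prems by (auto simp: even_state_def column_heights_def)
  then obtain x y where xy: "b = c + y" "a = c + y + x" by (metis le_iff_add)
  show ?case
    using step(4)[of "2 * n + 1"] Suc.IH[OF step(1)] Suc.IH[OF step(2)] Suc.IH[OF step(3)] le
    by (cases n; cases x; cases y) (auto simp: xy motzkin_rect_Suc motzkin_rect_0 numeral_3_eq_3)
qed

lemma even_state_Nil: "even_state [] 0 0 0"
  by (simp add: even_state_def good_word_Nil column_heights_def)

lemma motzkin_rect_1: "motzkin_rect n (Suc 0) (Suc 0) = motzkin (int n)"
  by (simp add: motzkin_rect_def motzkin_from_0)

lemma card_good_words_even: "card {ws. length ws = 2 * n \<and> good_word ws} = motzkin (int n)"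
  using card_completions_even[OF even_state_Nil, of n] by (simp add: completions_def motzkin_rect_1)

lemma card_good_words_odd:
  assumes "n \<ge> 1"
  shows "int (card {ws. length ws = 2 * n - 1 \<and> good_word ws}) =
    int (motzkin (int n)) - int (motzkin (int n - 2))"
proof -
  obtain m where m: "n = Suc m" using assms by (cases n) auto
  show ?thesis
    \<comment> \<open>For \<open>m = 0\<close> the correction is \<open>0\<close>, and so is
      \<open>motzkin (- 1)\<close>; for \<open>m = Suc k\<close> it is
      \<open>motzkin (int k)\<close> with \<open>k = n - 2\<close>.\<close>
    using card_completions_odd[OF even_state_Nil, of m] unfolding m
    by (cases m) (auto simp: completions_def motzkin_rect_1 motzkin_def)
qed

subsection \<open>Refilling a symmetric Ferrers board\<close>

definition dir :: "bool \<Rightarrow> nat \<Rightarrow> nat \<Rightarrow> bool" where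
  "dir t x y \<longleftrightarrow> (if t then x < y else y < x)"

locale symmetric_board =
  fixes G :: "nat \<Rightarrow> nat \<Rightarrow> bool" and S :: "nat set"
  assumes down: "G i v \<Longrightarrow> i' \<le> i \<Longrightarrow> v' \<le> v \<Longrightarrow> G i' v'"
    and sym: "G i v \<longleftrightarrow> G v i"
    and fin: "finite S"
begin

definition filling :: "(nat \<Rightarrow> nat) \<Rightarrow> bool" where
  "filling f \<longleftrightarrow> bij_betw f S S \<and> (\<forall>i\<in>S. G i (f i))"

text \<open>A copy counts only if its bounding rectangle lies in the board; as the board is closed
  downwards, the upper right corner decides.\<close>

definition free :: "bool \<Rightarrow> (nat \<Rightarrow> nat) \<Rightarrow> bool" where
  "free u f \<longleftrightarrow> (\<forall>i\<in>S. \<forall>j\<in>S. i < j \<and> dir u (f i) (f j) \<longrightarrow> \<not> G j (max (f i) (f j)))"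

lemma ex_free_filling:
  assumes "filling f0"
  obtains f where "filling f" "free u f"
proof -
  \<comment> \<open>Take a filling of extremal weight; exchanging the two values of a forbidden pair would improve it.\<close>
  define m where "m = Max S"
  define wt where "wt i = (if u then m - i else i)" for i
  define W where "W f = (\<Sum>i\<in>S. wt i * f i)" for f
  have le_m: "i \<le> m" if "i \<in> S" for i using that fin by (simp add: m_def)
  have "W f < Suc (\<Sum>i\<in>S. wt i * m)" if "filling f" for f
  proof -
    have "W f \<le> (\<Sum>i\<in>S. wt i * m)"
      unfolding W_def by (intro sum_mono mult_le_mono le_m) (use that in \<open>auto simp: filling_def bij_betw_def\<close>)
    then show ?thesis by simp
  qed
  then obtain f where f: "filling f" and max: "\<And>g. filling g \<Longrightarrow> W g \<le> W f"
    using ex_has_greatest_nat[of filling f0 W] assms by blast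
  have "free u f"
    unfolding free_def
  proof (intro ballI impI notI)
    fix i j assume ij: "i \<in> S" "j \<in> S" "i < j \<and> dir u (f i) (f j)" and G: "G j (max (f i) (f j))"
    define g where "g = f \<circ> Transposition.transpose i j"
    have g: "g i = f j" "g j = f i" "\<And>k. k \<noteq> i \<Longrightarrow> k \<noteq> j \<Longrightarrow> g k = f k"
      by (auto simp: g_def)
    have "bij_betw (Transposition.transpose i j) S S"
      using ij by (intro permutes_imp_bij permutes_swap_id)
    then have "bij_betw g S S"
      using f unfolding g_def filling_def by (auto intro: bij_betw_trans)
    moreover have "G k (g k)" if "k \<in> S" for k
    proof (cases "k = i \<or> k = j")
      case True
      then show ?thesis using down[OF G, of k "g k"] ij g by auto
    next
      case False
      then show ?thesis using f that g(3) by (auto simp: filling_def)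
    qed
    ultimately have "filling g" by (simp add: filling_def)
    have split: "W h = wt i * h i + (wt j * h j + (\<Sum>k\<in>S - {i} - {j}. wt k * h k))" for h
      unfolding W_def using ij fin by (subst sum.remove[of S i], simp_all) (subst sum.remove[of "S - {i}" j], auto)
    have rest: "(\<Sum>k\<in>S - {i} - {j}. wt k * g k) = (\<Sum>k\<in>S - {i} - {j}. wt k * f k)"
      by (intro sum.cong) (auto simp: g)
    have rearr: "a * c + b * d < a * d + b * c" if "a < b" "d < c" for a b c d :: nat
    proof -
      obtain x where x: "b = a + Suc x" using less_imp_Suc_add[OF \<open>a < b\<close>] by auto
      obtain y where y: "c = d + Suc y" using less_imp_Suc_add[OF \<open>d < c\<close>] by auto
      show ?thesis unfolding x y by (simp add: algebra_simps)
    qed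
    have "wt i * f i + wt j * f j < wt i * f j + wt j * f i"
    proof (cases u)
      case True
      have "m - j < m - i" using ij le_m[of j] by linarith
      then show ?thesis using rearr[of "wt j" "wt i" "f i" "f j"] ij True
        by (simp add: dir_def wt_def add.commute)
    next
      case False
      then show ?thesis using rearr[of "wt i" "wt j" "f j" "f i"] ij by (simp add: dir_def wt_def)
    qed
    then have "W f < W g" unfolding split rest g by simp
    then show False using max[OF \<open>filling g\<close>] by simp
  qed
  then show thesis using f that by blast
qed

text \<open>Suppose \<open>f i < g i\<close>. For \<open>12\<close>, \<open>g\<close> takes the
  value \<open>f i\<close> at some \<open>k < i\<close>, since both agree beyond \<open>i\<close>;
  then \<open>k\<close> and \<open>i\<close> form a copy in \<open>g\<close> with corner
  \<open>(i, g i)\<close> in the board. For \<open>21\<close>, \<open>f\<close> takes the value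
  \<open>g i\<close> at some \<open>k < i\<close>, with the same corner.\<close>

lemma free_filling_le:
  assumes f: "filling f" "free u f" and g: "filling g" "free u g" and i: "i \<in> S"
    and above: "\<And>k. k \<in> S \<Longrightarrow> i < k \<Longrightarrow> f k = g k"
  shows "g i \<le> f i"
proof (rule ccontr)
  assume "\<not> g i \<le> f i"
  then have less: "f i < g i" by simp
  have G: "G i (g i)" using g(1) i by (simp add: filling_def)
  have inj: "inj_on f S" "inj_on g S" and im: "f ` S = S" "g ` S = S"
    using f g by (auto simp: filling_def bij_betw_def)
  show False
  proof (cases u)
    case True
    obtain k where k: "k \<in> S" "g k = f i" using im i by (metis imageE imageI)
    have "k < i"
      using above[OF k(1)] k i less inj by (metis inj_onD less_irrefl linorder_neqE_nat)
    then have "\<not> G i (max (g k) (g i))" using g(2) k i less True by (auto simp: free_def dir_def)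
    then show False using G k less by (simp add: max_def)
  next
    case False
    obtain k where k: "k \<in> S" "f k = g i" using im i by (metis imageE imageI)
    have "k < i"
      using above[OF k(1)] k i less inj by (metis inj_onD less_irrefl linorder_neqE_nat)
    then have "\<not> G i (max (f k) (f i))" using f(2) k i less False by (auto simp: free_def dir_def)
    then show False using G k less by (simp add: max_def)
  qed
qed

lemma free_filling_unique:
  assumes f: "filling f" "free u f" and g: "filling g" "free u g" and "i \<in> S"
  shows "f i = g i"
proof (rule ccontr)
  assume "f i \<noteq> g i"
  define D where "D = {i \<in> S. f i \<noteq> g i}"
  have D: "finite D" "D \<noteq> {}" using fin assms(5) \<open>f i \<noteq> g i\<close> by (auto simp: D_def)
  define j where "j = Max D"
  have j: "j \<in> S" "f j \<noteq> g j" using Max_in[OF D] by (auto simp: j_def D_def)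
  have "f k = g k" if "k \<in> S" "j < k" for k
    using Max_ge[OF D(1), of k] that by (auto simp: j_def D_def)
  then show False
    using free_filling_le[OF f g j(1)] free_filling_le[OF g f j(1)] j(2) by (metis le_antisym)
qed

text \<open>Reflection preserves the board and both patterns, so the inverse of \<open>f\<close> is
  again a free filling and equals \<open>f\<close> by uniqueness.\<close>

lemma free_filling_involution:
  assumes f: "filling f" "free u f" and "i \<in> S"
  shows "f (f i) = i"
proof -
  define g where "g = inv_into S f"
  have bij: "bij_betw f S S" using f by (simp add: filling_def)
  have fg: "f (g k) = k" "g k \<in> S" if "k \<in> S" for k
    using that bij unfolding g_def by (auto simp: bij_betw_def f_inv_into_f inv_into_into)
  have "filling g"
    unfolding filling_def
  proof (intro conjI ballI)
    show "bij_betw g S S" unfolding g_def by (rule bij_betw_inv_into[OF bij])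
    show "G k (g k)" if "k \<in> S" for k
      using f(1) fg[OF that] sym unfolding filling_def by metis
  qed
  moreover have "free u g"
    unfolding free_def
  proof (intro ballI impI notI)
    fix k l assume kl: "k \<in> S" "l \<in> S" "k < l \<and> dir u (g k) (g l)" and G: "G l (max (g k) (g l))"
    show False
    proof (cases u)
      case True
      then have "g k < g l" using kl by (simp add: dir_def)
      then have "\<not> G (g l) l"
        using f(2)[unfolded free_def, rule_format, of "g k" "g l"] fg kl True by (simp add: dir_def max_def)
      then show False using G \<open>g k < g l\<close> sym[of l "g l"] by (simp add: max_def)
    next
      case False
      then have "g l < g k" using kl by (simp add: dir_def)
      then have "\<not> G (g k) l"
        using f(2)[unfolded free_def, rule_format, of "g l" "g k"] fg kl False by (simp add: dir_def max_def)
      then show False using G \<open>g l < g k\<close> sym[of l "g k"] by (simp add: max_def)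
    qed
  qed
  ultimately have "g (f i) = f (f i)"
    using free_filling_unique[OF f] bij assms(3) by (metis bij_betwE)
  then show ?thesis using bij assms(3) unfolding g_def by (simp add: bij_betw_def)
qed

end

section \<open>Boards below and to the left of a copy of 12 or 21\<close>

text \<open>
  Patterns are encoded by booleans: \<open>True\<close> stands for \<open>12\<close> and \<open>False\<close> for \<open>21\<close>. The board \<open>above N t p\<close>
  consists of the cells with a copy of \<open>t\<close> strictly above and to the right, and \<open>occurs N u t\<close> is
  containment of \<open>u \<oplus> t\<close>.
\<close>

definition above :: "nat \<Rightarrow> bool \<Rightarrow> (nat \<Rightarrow> nat) \<Rightarrow> nat \<Rightarrow> nat \<Rightarrow> bool" where
  "above N t p i v \<longleftrightarrow> (\<exists>a b. i < a \<and> a < b \<and> b \<le> N \<and> v < p a \<and> v < p b \<and> dir t (p a) (p b))"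

definition occurs :: "nat \<Rightarrow> bool \<Rightarrow> bool \<Rightarrow> (nat \<Rightarrow> nat) \<Rightarrow> bool" where
  "occurs N u t p \<longleftrightarrow> (\<exists>i j. 1 \<le> i \<and> i < j \<and> dir u (p i) (p j) \<and> above N t p j (max (p i) (p j)))"

definition coloured :: "nat \<Rightarrow> bool \<Rightarrow> (nat \<Rightarrow> nat) \<Rightarrow> nat set" where
  "coloured N t p = {i \<in> {1..N}. above N t p i (p i)}"

lemma above_mono: "above N t p i v \<Longrightarrow> i' \<le> i \<Longrightarrow> v' \<le> v \<Longrightarrow> above N t p i' v'"
  unfolding above_def by (meson le_less_trans)

text \<open>This makes the board invariant under refilling its coloured cells.\<close>

lemma above_uncoloured:
  assumes "above N t p i v" "p permutes {1..N}"
  obtains a b where "i < a" "a < b" "b \<le> N" "v < p a" "v < p b" "dir t (p a) (p b)"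
    "a \<notin> coloured N t p" "b \<notin> coloured N t p"
proof -
  \<comment> \<open>A lexicographically maximal copy works: a coloured entry would have a higher copy above it.\<close>
  define P where "P = (\<lambda>(a, b). i < a \<and> a < b \<and> b \<le> N \<and> v < p a \<and> v < p b \<and> dir t (p a) (p b))"
  define w where "w = (\<lambda>(a, b). p a * Suc N + p b)"
  have bound: "p k \<le> N" if "k \<in> {1..N}" for k
    using permutes_in_image[OF assms(2)] that by (metis atLeastAtMost_iff)
  have "w x < Suc (N * Suc N + N)" if "P x" for x
  proof -
    obtain a b where x: "x = (a, b)" by fastforce
    have "a \<in> {1..N}" "b \<in> {1..N}" using that by (auto simp: P_def x)
    then have "p a \<le> N" "p b \<le> N" using bound by blast+
    then have "p a * Suc N + p b \<le> N * Suc N + N" by (intro add_mono mult_le_mono1)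
    then show ?thesis by (simp add: w_def x)
  qed
  moreover obtain x0 where "P x0" using assms(1) by (auto simp: above_def P_def)
  ultimately obtain x where x: "P x" and max: "\<And>y. P y \<Longrightarrow> w y \<le> w x"
    using ex_has_greatest_nat[of P x0 w] by blast
  obtain a b where ab: "x = (a, b)" by fastforce
  note P = x[unfolded ab P_def, simplified]
  have max1: "p c \<le> p a" if "P (c, d)" for c d
  proof (rule ccontr)
    assume "\<not> p c \<le> p a"
    then have "Suc (p a) * Suc N \<le> p c * Suc N" by (intro mult_le_mono1) simp
    moreover have "p b \<le> N" using bound P by auto
    ultimately show False using max[OF that] by (simp add: w_def ab)
  qed
  have max2: "p d \<le> p b" if "P (a, d)" for d
    using max[OF that] by (simp add: w_def ab)
  have "a \<notin> coloured N t p"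
  proof
    assume "a \<in> coloured N t p"
    then obtain c d where cd: "a < c" "c < d" "d \<le> N" "p a < p c" "p a < p d" "dir t (p c) (p d)"
      by (auto simp: coloured_def above_def)
    then show False using max1[of c d] P by (auto simp: P_def)
  qed
  moreover have "b \<notin> coloured N t p"
  proof
    assume "b \<in> coloured N t p"
    then obtain c d where cd: "b < c" "c < d" "d \<le> N" "p b < p c" "p b < p d" "dir t (p c) (p d)"
      by (auto simp: coloured_def above_def)
    have 1: "p c \<le> p a" using max1[of c d] cd P by (auto simp: P_def)
    moreover have "p c \<noteq> p a"
      using cd P permutes_inj[OF assms(2)] by (metis inj_eq less_trans less_irrefl)
    ultimately show False using max2[of c] cd P by (auto simp: P_def dir_def split: if_splits)
  qed
  ultimately show thesis using that P by blast
qed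

text \<open>Reflection in the diagonal maps copies of \<open>12\<close> and of \<open>21\<close> to
  copies of the same pattern; for \<open>21\<close> the two points change places.\<close>

lemma (in involution_on) above_sym_imp:
  assumes "above N t p i v"
  shows "above N t p v i"
proof -
  obtain a b where ab: "i < a" "a < b" "b \<le> N" "v < p a" "v < p b" "dir t (p a) (p b)"
    using assms by (auto simp: above_def)
  then have "a \<in> {1..N}" "b \<in> {1..N}" by auto
  then have "p a \<le> N" "p b \<le> N"
    using permutes_in_image[OF permutes] by (meson atLeastAtMost_iff)+
  show ?thesis
  proof (cases t)
    case True
    then show ?thesis using ab \<open>p b \<le> N\<close> involutive unfolding above_def
      by (intro exI[of _ "p a"] exI[of _ "p b"]) (auto simp: dir_def)
  next
    case False
    then show ?thesis using ab \<open>p a \<le> N\<close> involutive unfolding above_def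
      by (intro exI[of _ "p b"] exI[of _ "p a"]) (auto simp: dir_def)
  qed
qed

lemma (in involution_on) above_sym: "above N t p i v \<longleftrightarrow> above N t p v i"
  using above_sym_imp by blast

lemma (in involution_on) board: "symmetric_board (above N t p) (coloured N t p)"
proof
  show "finite (coloured N t p)" by (simp add: coloured_def)
qed (use above_mono above_sym in blast)+

lemma (in involution_on) coloured_image: "i \<in> coloured N t p \<Longrightarrow> p i \<in> coloured N t p"
proof -
  assume i: "i \<in> coloured N t p"
  then have "p i \<in> {1..N}" using permutes_in_image[OF permutes] by (auto simp: coloured_def)
  then show "p i \<in> coloured N t p" using i above_sym involutive by (simp add: coloured_def)
qed

lemma (in involution_on) filling_self:
  "symmetric_board.filling (above N t p) (coloured N t p) p"
  unfolding symmetric_board.filling_def[OF board]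
proof
  show "bij_betw p (coloured N t p) (coloured N t p)"
    by (rule bij_betw_byWitness[of _ p]) (auto simp: involutive coloured_image)
qed (auto simp: coloured_def)

lemma (in involution_on) free_self:
  assumes "\<not> occurs N u t p"
  shows "symmetric_board.free (above N t p) (coloured N t p) u p"
  using assms unfolding symmetric_board.free_def[OF board]
  by (auto simp: occurs_def coloured_def)

section \<open>Exchanging the prefixes 12 and 21 in alternating involutions\<close>

definition avoiders :: "nat \<Rightarrow> bool \<Rightarrow> bool \<Rightarrow> (nat \<Rightarrow> nat) set" where
  "avoiders N u t = {p. involution_on N p \<and> alternating N p \<and> \<not> occurs N u t p}"

text \<open>A coloured peak would form \<open>12\<close> with its left neighbour or
  \<open>21\<close> with its right neighbour, below a copy of \<open>t\<close>. In the second case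
  the neighbour is too low to belong to that copy.\<close>

lemma peak_uncoloured:
  assumes "p \<in> avoiders N u t" "even i"
  shows "i \<notin> coloured N t p"
proof
  assume i: "i \<in> coloured N t p"
  have alt: "\<And>i. 1 \<le> i \<Longrightarrow> i < N \<Longrightarrow> p i < p (i + 1) \<longleftrightarrow> odd i" and occ: "\<not> occurs N u t p"
    and inv: "involution_on N p"
    using assms(1) by (auto simp: avoiders_def alternating_def)
  have ab: "above N t p i (p i)" and range: "1 \<le> i" "i \<le> N" using i by (auto simp: coloured_def)
  show False
  proof (cases u)
    case True
    obtain k where k: "i = Suc k" "1 \<le> k" using range assms(2) by (cases i) (auto simp: Suc_le_eq elim: oddE)
    then have "p k < p i" using alt[of k] assms(2) range by auto
    then have "occurs N True t p" using ab k unfolding occurs_def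
      by (intro exI[of _ k] exI[of _ i]) (auto simp: dir_def max_def)
    then show False using occ True by simp
  next
    case False
    obtain a b where a: "i < a" "a < b" "b \<le> N" "p i < p a" "p i < p b" "dir t (p a) (p b)"
      using ab by (auto simp: above_def)
    have "\<not> p i < p (i + 1)" using alt[of i] a range assms(2) by auto
    moreover have "p i \<noteq> p (i + 1)" using involution_on.inj[OF inv] by simp
    ultimately have less: "p (i + 1) < p i" by simp
    then have "a \<noteq> i + 1" using a by auto
    then have "above N t p (i + 1) (p i)" using a unfolding above_def
      by (intro exI[of _ a] exI[of _ b]) auto
    then have "occurs N False t p" using less range unfolding occurs_def
      by (intro exI[of _ i] exI[of _ "i + 1"]) (auto simp: dir_def max_def)
    then show False using occ False by simp
  qed
qed

text \<open>What refilling leaves fixed. A class that has an avoider for one prefix has exactly one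
  for each prefix.\<close>

definition same_shape :: "nat \<Rightarrow> bool \<Rightarrow> (nat \<Rightarrow> nat) \<Rightarrow> (nat \<Rightarrow> nat) \<Rightarrow> bool" where
  "same_shape N t p q \<longleftrightarrow> above N t p = above N t q \<and> coloured N t p = coloured N t q \<and>
    (\<forall>i. i \<notin> coloured N t p \<longrightarrow> p i = q i)"

lemma same_shape_unique:
  assumes "q \<in> avoiders N u t" "q' \<in> avoiders N u t" "same_shape N t p q" "same_shape N t p q'"
  shows "q = q'"
proof
  fix i
  interpret Q: involution_on N q using assms by (simp add: avoiders_def)
  interpret Q': involution_on N q' using assms by (simp add: avoiders_def)
  have eq: "above N t q' = above N t q" "coloured N t q' = coloured N t q"
    using assms by (auto simp: same_shape_def)
  show "q i = q' i"
  proof (cases "i \<in> coloured N t q")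
    case True
    have occ: "\<not> occurs N u t q" "\<not> occurs N u t q'" using assms by (auto simp: avoiders_def)
    show ?thesis
      by (rule symmetric_board.free_filling_unique[OF Q.board Q.filling_self Q.free_self[OF occ(1)]
            Q'.filling_self[of t, unfolded eq] Q'.free_self[OF occ(2), unfolded eq] True])
  next
    case False
    then show ?thesis using assms(3,4) by (auto simp: same_shape_def)
  qed
qed

lemma ex_same_shape:
  assumes p: "p \<in> avoiders N u t"
  shows "\<exists>q\<in>avoiders N u' t. same_shape N t p q"
proof -
  interpret P: involution_on N p using p by (simp add: avoiders_def)
  define G where "G = above N t p"
  define S where "S = coloured N t p"
  interpret B: symmetric_board G S unfolding G_def S_def by (rule P.board)
  obtain f where f: "B.filling f" "B.free u' f"
    using B.ex_free_filling P.filling_self[of t] unfolding G_def S_def by metis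
  have bij: "bij_betw f S S" and Gf: "\<And>i. i \<in> S \<Longrightarrow> G i (f i)" using f by (auto simp: B.filling_def)
  define q where "q i = (if i \<in> S then f i else p i)" for i
  have fS: "f i \<in> S" if "i \<in> S" for i using bij that by (rule bij_betwE[rule_format])
  have pS: "p i \<notin> S" if "i \<notin> S" for i
    using P.coloured_image[of "p i" t] that P.involutive unfolding S_def by auto
  have inv: "q (q i) = i" for i
    using B.free_filling_involution[OF f] fS pS P.involutive by (simp add: q_def)
  have S: "S \<subseteq> {1..N}" by (auto simp: S_def coloured_def)
  have "q permutes {1..N}"
    unfolding permutes_def
  proof (intro conjI allI impI)
    show "q x = x" if "x \<notin> {1..N}" for x
      using that S permutes_not_in[OF P.permutes that] by (auto simp: q_def)
    show "\<exists>!x. q x = y" for y using inv by metis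
  qed
  then interpret Q: involution_on N q using inv by unfold_locales
  \<comment> \<open>The board is unchanged: a new copy through a coloured cell places
    \<open>(i, v)\<close> in the old board by downward closure, and each cell of the old board has
    an uncoloured copy, which survives.\<close>
  have above: "above N t q i v \<longleftrightarrow> G i v" for i v
  proof
    assume "above N t q i v"
    then obtain a b where ab: "i < a" "a < b" "b \<le> N" "v < q a" "v < q b" "dir t (q a) (q b)"
      by (auto simp: above_def)
    show "G i v"
    proof (cases "a \<in> S \<or> b \<in> S")
      case True
      then show ?thesis using B.down[OF Gf, of a i v] B.down[OF Gf, of b i v] ab by (auto simp: q_def)
    next
      case False
      then show ?thesis using ab unfolding G_def above_def q_def by auto
    qed
  next
    assume "G i v"
    then obtain a b where "i < a" "a < b" "b \<le> N" "v < p a" "v < p b" "dir t (p a) (p b)" "a \<notin> S" "b \<notin> S"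
      using above_uncoloured[OF _ P.permutes] unfolding G_def S_def by metis
    then show "above N t q i v" unfolding above_def
      by (intro exI[of _ a] exI[of _ b]) (simp add: q_def)
  qed
  have col: "coloured N t q = S"
    using S Gf above by (auto simp: coloured_def q_def) (auto simp: S_def G_def coloured_def)
  have shape: "same_shape N t p q"
    unfolding same_shape_def using above col by (auto simp: G_def S_def q_def fun_eq_iff)
  have alt: "\<And>i. 1 \<le> i \<Longrightarrow> i < N \<Longrightarrow> p i < p (i + 1) \<longleftrightarrow> odd i"
    using p by (auto simp: avoiders_def alternating_def)
  have peak: "i \<notin> S" if "even i" for i using peak_uncoloured[OF p that] by (simp add: S_def)
  \<comment> \<open>Only valleys change. A refilled valley higher than a neighbouring peak would
    bring this peak into the board, contrary to \<open>peak\<close>.\<close>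
  have "q i < q (i + 1) \<longleftrightarrow> odd i" if i: "1 \<le> i" "i < N" for i
  proof (cases "odd i")
    case True
    then have p1: "q (i + 1) = p (i + 1)" "i + 1 \<notin> S" using peak[of "i + 1"] by (auto simp: q_def)
    have "q i < q (i + 1)"
    proof (cases "i \<in> S")
      case False
      then show ?thesis using p1 alt[OF i] True by (simp add: q_def)
    next
      case iS: True
      show ?thesis
      proof (rule ccontr)
        assume "\<not> q i < q (i + 1)"
        moreover have "q i \<noteq> q (i + 1)" using Q.inj by simp
        ultimately have less: "p (i + 1) < q i" using p1 by simp
        have "above N t p i (q i)" using Gf[OF iS] iS by (simp add: G_def q_def)
        then obtain a b where a: "i < a" "a < b" "b \<le> N" "q i < p a" "q i < p b" "dir t (p a) (p b)"
          by (auto simp: above_def)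
        have "a \<noteq> i + 1" using a less by auto
        then have "above N t p (i + 1) (p (i + 1))" using a less unfolding above_def
          by (intro exI[of _ a] exI[of _ b]) auto
        then show False using p1 i by (simp add: S_def coloured_def)
      qed
    qed
    then show ?thesis using True by simp
  next
    case False
    then have p1: "q i = p i" "i \<notin> S" using peak[of i] by (auto simp: q_def)
    have "\<not> q i < q (i + 1)"
    proof
      assume less: "q i < q (i + 1)"
      have "i + 1 \<in> S" using less p1 alt[OF i] False by (auto simp: q_def split: if_splits)
      then have "G (i + 1) (q (i + 1))" using Gf by (simp add: q_def)
      then have "G i (p i)" using B.down less p1 by (metis le_add1 less_imp_le)
      then show False using p1 i by (simp add: S_def coloured_def G_def)
    qed
    then show ?thesis using False by simp
  qed
  then have "alternating N q" by (simp add: alternating_def)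
  \<comment> \<open>The prefix of an occurrence would lie in the board, hence on coloured cells,
    where \<open>q\<close> is the free filling \<open>f\<close>.\<close>
  moreover have "\<not> occurs N u' t q"
  proof
    assume "occurs N u' t q"
    then obtain i j where ij: "1 \<le> i" "i < j" "dir u' (q i) (q j)" "G j (max (q i) (q j))"
      by (auto simp: occurs_def above)
    have "j \<le> N" using ij(4) by (auto simp: G_def above_def)
    have "G i (q i)" "G j (q j)"
      using B.down[OF ij(4), of i "q i"] B.down[OF ij(4), of j "q j"] ij(2) by auto
    then have "i \<in> S" "j \<in> S" using ij \<open>j \<le> N\<close> unfolding col[symmetric] coloured_def by (auto simp: above)
    then show False using f(2) ij by (auto simp: B.free_def q_def)
  qed
  ultimately have "q \<in> avoiders N u' t" using Q.involution_on_axioms by (simp add: avoiders_def)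
  then show ?thesis using shape by blast
qed

lemma finite_avoiders: "finite (avoiders N u t)"
  by (rule finite_subset[OF _ finite_permutations[of "{1..N}"]])
    (auto simp: avoiders_def involution_on_def)

lemma same_shape_sym: "same_shape N t p q \<Longrightarrow> same_shape N t q p"
  by (auto simp: same_shape_def)

text \<open>Any choice of an avoider of the same shape is injective, by uniqueness within a
  shape.\<close>

lemma card_avoiders_le: "card (avoiders N u t) \<le> card (avoiders N u' t)"
proof -
  have "\<forall>p\<in>avoiders N u t. \<exists>q. q \<in> avoiders N u' t \<and> same_shape N t p q"
    using ex_same_shape by blast
  from bchoice[OF this] obtain h
    where h: "\<forall>p\<in>avoiders N u t. h p \<in> avoiders N u' t \<and> same_shape N t p (h p)" by blast
  have "inj_on h (avoiders N u t)"
  proof (rule inj_onI)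
    fix p q assume pq: "p \<in> avoiders N u t" "q \<in> avoiders N u t" "h p = h q"
    then have "same_shape N t (h p) p" "same_shape N t (h p) q" using h same_shape_sym by metis+
    then show "p = q" using same_shape_unique pq by blast
  qed
  then show ?thesis using h finite_avoiders by (intro card_inj_on_le[of h]) auto
qed

lemma card_avoiders_eq: "card (avoiders N u t) = card (avoiders N u' t)"
  using card_avoiders_le by (metis le_antisym)

subsection \<open>Patterns and symmetries\<close>

lemma nth_four: "[x1, x2, x3, x4] ! 0 = x1" "[x1, x2, x3, x4] ! 1 = x2"
  "[x1, x2, x3, x4] ! 2 = x3" "[x1, x2, x3, x4] ! 3 = x4"
  by (simp_all add: numeral_2_eq_2 numeral_3_eq_3)

lemma contains_pattern_four:
  "contains_pattern n p [x1, x2, x3, x4] \<longleftrightarrow>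
    (\<exists>i1 i2 i3 i4. 1 \<le> i1 \<and> i1 < i2 \<and> i2 < i3 \<and> i3 < i4 \<and> i4 \<le> n \<and>
      (p i1 < p i2 \<longleftrightarrow> x1 < x2) \<and> (p i1 < p i3 \<longleftrightarrow> x1 < x3) \<and> (p i1 < p i4 \<longleftrightarrow> x1 < x4) \<and>
      (p i2 < p i1 \<longleftrightarrow> x2 < x1) \<and> (p i2 < p i3 \<longleftrightarrow> x2 < x3) \<and> (p i2 < p i4 \<longleftrightarrow> x2 < x4) \<and>
      (p i3 < p i1 \<longleftrightarrow> x3 < x1) \<and> (p i3 < p i2 \<longleftrightarrow> x3 < x2) \<and> (p i3 < p i4 \<longleftrightarrow> x3 < x4) \<and>
      (p i4 < p i1 \<longleftrightarrow> x4 < x1) \<and> (p i4 < p i2 \<longleftrightarrow> x4 < x2) \<and> (p i4 < p i3 \<longleftrightarrow> x4 < x3))"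
  (is "_ = (\<exists>i1 i2 i3 i4. ?Q i1 i2 i3 i4)")
proof
  have idx: "{..<4::nat} = {0, 1, 2, 3}" by auto
  have len: "length [x1, x2, x3, x4] = 4" by simp
  assume "contains_pattern n p [x1, x2, x3, x4]"
  then obtain f :: "nat \<Rightarrow> nat" where f: "strict_mono_on {..<4} f" "f ` {..<4} \<subseteq> {1..n}"
    "\<forall>a<4. \<forall>b<4. p (f a) < p (f b) \<longleftrightarrow> [x1, x2, x3, x4] ! a < [x1, x2, x3, x4] ! b"
    unfolding contains_pattern_def len by (elim exE conjE)
  have cmp: "p (f a) < p (f b) \<longleftrightarrow> [x1, x2, x3, x4] ! a < [x1, x2, x3, x4] ! b" if "a < 4" "b < 4" for a b
    using f(3) that by simp
  have "1 \<le> f 0" "f 0 < f 1" "f 1 < f 2" "f 2 < f 3" "f 3 \<le> n"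
    using f(1,2) by (auto simp: idx strict_mono_on_def)
  moreover have "p (f 0) < p (f 1) \<longleftrightarrow> x1 < x2"
    "p (f 0) < p (f 2) \<longleftrightarrow> x1 < x3"
    "p (f 0) < p (f 3) \<longleftrightarrow> x1 < x4"
    "p (f 1) < p (f 0) \<longleftrightarrow> x2 < x1"
    "p (f 1) < p (f 2) \<longleftrightarrow> x2 < x3"
    "p (f 1) < p (f 3) \<longleftrightarrow> x2 < x4"
    "p (f 2) < p (f 0) \<longleftrightarrow> x3 < x1"
    "p (f 2) < p (f 1) \<longleftrightarrow> x3 < x2"
    "p (f 2) < p (f 3) \<longleftrightarrow> x3 < x4"
    "p (f 3) < p (f 0) \<longleftrightarrow> x4 < x1"
    "p (f 3) < p (f 1) \<longleftrightarrow> x4 < x2"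
    "p (f 3) < p (f 2) \<longleftrightarrow> x4 < x3"
    by (simp_all add: cmp nth_four)
  ultimately show "\<exists>i1 i2 i3 i4. ?Q i1 i2 i3 i4"
    by (intro exI[of _ "f 0"] exI[of _ "f 1"] exI[of _ "f 2"] exI[of _ "f 3"] conjI)
next
  assume "\<exists>i1 i2 i3 i4. ?Q i1 i2 i3 i4"
  then obtain i1 i2 i3 i4 where i: "1 \<le> i1" "i1 < i2" "i2 < i3" "i3 < i4" "i4 \<le> n"
    and Q: "p i1 < p i2 \<longleftrightarrow> x1 < x2"
    "p i1 < p i3 \<longleftrightarrow> x1 < x3"
    "p i1 < p i4 \<longleftrightarrow> x1 < x4"
    "p i2 < p i1 \<longleftrightarrow> x2 < x1"
    "p i2 < p i3 \<longleftrightarrow> x2 < x3"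
    "p i2 < p i4 \<longleftrightarrow> x2 < x4"
    "p i3 < p i1 \<longleftrightarrow> x3 < x1"
    "p i3 < p i2 \<longleftrightarrow> x3 < x2"
    "p i3 < p i4 \<longleftrightarrow> x3 < x4"
    "p i4 < p i1 \<longleftrightarrow> x4 < x1"
    "p i4 < p i2 \<longleftrightarrow> x4 < x2"
    "p i4 < p i3 \<longleftrightarrow> x4 < x3"
    by (elim exE conjE)
  have less4: "a = 0 \<or> a = 1 \<or> a = 2 \<or> a = 3" if "a < 4" for a :: nat using that by linarith
  show "contains_pattern n p [x1, x2, x3, x4]"
    unfolding contains_pattern_def
  proof (intro exI[of _ "\<lambda>k. [i1, i2, i3, i4] ! k"] conjI allI impI)
    show "strict_mono_on {..<length [x1, x2, x3, x4]} (\<lambda>k. [i1, i2, i3, i4] ! k)"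
      using i by (auto simp: strict_mono_on_def less_Suc_eq)
    show "(\<lambda>k. [i1, i2, i3, i4] ! k) ` {..<length [x1, x2, x3, x4]} \<subseteq> {1..n}"
      using i by (auto simp: less_Suc_eq)
    fix a b assume "a < length [x1, x2, x3, x4]" "b < length [x1, x2, x3, x4]"
    then have "a < 4" "b < 4" by auto
    from less4[OF this(1)] less4[OF this(2)] show "(p ([i1, i2, i3, i4] ! a) < p ([i1, i2, i3, i4] ! b)) =
        ([x1, x2, x3, x4] ! a < [x1, x2, x3, x4] ! b)"
      by (elim disjE) (simp_all only: nth_four Q less_irrefl)
  qed
qed

lemma occurs_four:
  "occurs n u t p \<longleftrightarrow> (\<exists>i1 i2 i3 i4. 1 \<le> i1 \<and> i1 < i2 \<and> i2 < i3 \<and> i3 < i4 \<and> i4 \<le> n \<and>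
    dir u (p i1) (p i2) \<and> dir t (p i3) (p i4) \<and> max (p i1) (p i2) < min (p i3) (p i4))"
  unfolding occurs_def above_def by (auto simp: conj_commute)

lemma contains_iff_occurs:
  "contains_pattern n p [1, 2, 3, 4] \<longleftrightarrow> occurs n True True p"
  "contains_pattern n p [1, 2, 4, 3] \<longleftrightarrow> occurs n True False p"
  "contains_pattern n p [2, 1, 4, 3] \<longleftrightarrow> occurs n False False p"
  "contains_pattern n p [2, 1, 3, 4] \<longleftrightarrow> occurs n False True p"
  unfolding contains_pattern_four occurs_four dir_def
  by (intro ex_cong1; auto)+

lemma involution_on_iff: "involution_on n p \<longleftrightarrow> p permutes {1..n} \<and> p = inv p"
proof
  assume "involution_on n p"
  then interpret involution_on n p .
  have "p \<circ> p = id" using involutive by auto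
  then show "p permutes {1..n} \<and> p = inv p" using permutes inv_unique_comp by metis
next
  assume "p permutes {1..n} \<and> p = inv p"
  then show "involution_on n p" by unfold_locales (simp, metis permutes_inverses(2))
qed

lemma AI_avoiding_eq:
  "AI_avoiding n [1, 2, 4, 3] = avoiders n True False"
  "AI_avoiding n [2, 1, 4, 3] = avoiders n False False"
  "AI_avoiding n [2, 1, 3, 4] = avoiders n False True"
  unfolding AI_avoiding_def AI_def avoiders_def involution_on_iff contains_iff_occurs by auto

section \<open>From involutions avoiding 1234 to words\<close>

lemma (in involution_on) chain_Suc_iff:
  assumes "i \<le> N"
  shows "chain (Suc k) i j \<longleftrightarrow> (\<exists>i'. 1 \<le> i' \<and> i' \<le> i \<and> p i' \<le> j \<and> chain k (i' - 1) (p i' - 1))"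
proof
  assume "chain (Suc k) i j"
  then obtain i' j' where "i' < i" "j' < j" "p (Suc i') = Suc j'" "chain k i' j'" by auto
  then show "\<exists>i'. 1 \<le> i' \<and> i' \<le> i \<and> p i' \<le> j \<and> chain k (i' - 1) (p i' - 1)"
    by (intro exI[of _ "Suc i'"]) auto
next
  assume "\<exists>i'. 1 \<le> i' \<and> i' \<le> i \<and> p i' \<le> j \<and> chain k (i' - 1) (p i' - 1)"
  then obtain i' where i': "1 \<le> i'" "i' \<le> i" "p i' \<le> j" "chain k (i' - 1) (p i' - 1)" by blast
  have "p i' > 0" using Suc_pos[of "i' - 1"] i' by simp
  then have "i' - 1 < i" "p i' - 1 < j" "p (Suc (i' - 1)) = Suc (p i' - 1)" using i' by auto
  then show "chain (Suc k) i j" using i'(4) unfolding chain.simps by blast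
qed

text \<open>A chain unfolds from its last point backwards; the bounds with \<open>- 1\<close> are
  strict inequalities because positions and values are positive.\<close>

lemma (in involution_on) occurs_increasing_iff_chain: "occurs N True True p \<longleftrightarrow> chain 4 N N"
proof -
  have pos: "p i > 0" if "1 \<le> i" for i using Suc_pos[of "i - 1"] that by simp
  have "chain 4 N N \<longleftrightarrow> (\<exists>i4. 1 \<le> i4 \<and> i4 \<le> N \<and> p i4 \<le> N \<and>
      (\<exists>i3. 1 \<le> i3 \<and> i3 \<le> i4 - 1 \<and> p i3 \<le> p i4 - 1 \<and>
      (\<exists>i2. 1 \<le> i2 \<and> i2 \<le> i3 - 1 \<and> p i2 \<le> p i3 - 1 \<and>
      (\<exists>i1. 1 \<le> i1 \<and> i1 \<le> i2 - 1 \<and> p i1 \<le> p i2 - 1))))"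
    by (simp add: eval_nat_numeral chain_Suc_iff cong: conj_cong del: chain.simps(2))
  also have "\<dots> \<longleftrightarrow> (\<exists>i1 i2 i3 i4. 1 \<le> i1 \<and> i1 < i2 \<and> i2 < i3 \<and> i3 < i4 \<and> i4 \<le> N \<and>
      p i1 < p i2 \<and> p i2 < p i3 \<and> p i3 < p i4)"
  proof (intro iffI; elim exE conjE)
    fix i1 i2 i3 i4
    assume "1 \<le> i1" "i1 < i2" "i2 < i3" "i3 < i4" "i4 \<le> N" "p i1 < p i2" "p i2 < p i3" "p i3 < p i4"
    moreover have "p i4 \<le> N" using le_N[of "i4 - 1"] calculation by simp
    ultimately show "\<exists>i4. 1 \<le> i4 \<and> i4 \<le> N \<and> p i4 \<le> N \<and>
      (\<exists>i3. 1 \<le> i3 \<and> i3 \<le> i4 - 1 \<and> p i3 \<le> p i4 - 1 \<and>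
      (\<exists>i2. 1 \<le> i2 \<and> i2 \<le> i3 - 1 \<and> p i2 \<le> p i3 - 1 \<and>
      (\<exists>i1. 1 \<le> i1 \<and> i1 \<le> i2 - 1 \<and> p i1 \<le> p i2 - 1)))"
      by (intro exI[of _ i4] exI[of _ i3] exI[of _ i2] exI[of _ i1] conjI) linarith+
  next
    fix i4 i3 i2 i1
    assume "1 \<le> i1" "i1 \<le> i2 - 1" "1 \<le> i2" "i2 \<le> i3 - 1" "1 \<le> i3" "i3 \<le> i4 - 1" "1 \<le> i4" "i4 \<le> N"
      "p i1 \<le> p i2 - 1" "p i2 \<le> p i3 - 1" "p i3 \<le> p i4 - 1"
    moreover note pos[of i1] pos[of i2] pos[of i3]
    ultimately show "\<exists>i1 i2 i3 i4. 1 \<le> i1 \<and> i1 < i2 \<and> i2 < i3 \<and> i3 < i4 \<and> i4 \<le> N \<and>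
      p i1 < p i2 \<and> p i2 < p i3 \<and> p i3 < p i4"
      by (intro exI[of _ i1] exI[of _ i2] exI[of _ i3] exI[of _ i4] conjI) linarith+
  qed
  also have "\<dots> \<longleftrightarrow> occurs N True True p"
    unfolding occurs_four dir_def by (intro ex_cong1) auto
  finally show ?thesis by simp
qed

lemma (in involution_on) good_growth_word_iff:
  "good_word (growth_word N p) \<longleftrightarrow> p \<in> avoiders N True True"
proof -
  have len: "length (growth_word N p) = N" by (simp add: growth_word_def)
  have "three_column_word (growth_word N p) \<longleftrightarrow> label_count p 1 N N \<le> 3"
    using count_list_growth_word[of N N p 1] len lattice_growth_word
    by (simp add: three_column_word_def)
  also have "\<dots> \<longleftrightarrow> \<not> occurs N True True p"
    unfolding occurs_increasing_iff_chain chain_iff_label_count by linarith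
  finally have 1: "three_column_word (growth_word N p) \<longleftrightarrow> \<not> occurs N True True p" .
  have "alternating_word (growth_word N p) \<longleftrightarrow>
      (\<forall>i. Suc i < N \<longrightarrow> (p (Suc i) < p (Suc (Suc i)) \<longleftrightarrow> odd (Suc i)))"
    using label_ascent_iff by (auto simp: alternating_word_def growth_word_def)
  also have "\<dots> \<longleftrightarrow> alternating N p"
  proof -
    have "(\<forall>i. Suc i < N \<longrightarrow> P (Suc i)) \<longleftrightarrow> (\<forall>i. 1 \<le> i \<and> i < N \<longrightarrow> P i)" for P
      by (metis One_nat_def Suc_le_D le_add1 plus_1_eq_Suc)
    from this[of "\<lambda>i. p i < p (Suc i) \<longleftrightarrow> odd i"] show ?thesis by (simp add: alternating_def)
  qed
  finally show ?thesis using 1 involution_on_axioms by (auto simp: good_word_def avoiders_def)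
qed

lemma card_avoiders_increasing:
  "card (avoiders N True True) = card {ws. length ws = N \<and> good_word ws}"
proof (rule bij_betw_same_card[of "growth_word N"], unfold bij_betw_def, intro conjI)
  show "inj_on (growth_word N) (avoiders N True True)"
  proof (rule inj_onI)
    fix p q assume "p \<in> avoiders N True True" "q \<in> avoiders N True True" "growth_word N p = growth_word N q"
    then show "p = q"
      by (intro growth_label_inj[of N p q]) (auto simp: avoiders_def growth_word_def)
  qed
  show "growth_word N ` avoiders N True True = {ws. length ws = N \<and> good_word ws}"
  proof (intro equalityI subsetI)
    fix ws assume "ws \<in> growth_word N ` avoiders N True True"
    then obtain p where p: "p \<in> avoiders N True True" "ws = growth_word N p" by blast
    then have "involution_on N p" by (simp add: avoiders_def)
    then show "ws \<in> {ws. length ws = N \<and> good_word ws}"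
      using involution_on.good_growth_word_iff p by (simp add: growth_word_def)
  next
    fix ws assume "ws \<in> {ws. length ws = N \<and> good_word ws}"
    then have ws: "length ws = N" "good_word ws" by auto
    then have "lattice_word ws" by (simp add: good_word_def three_column_word_def)
    then obtain p where p: "involution_on N p" "growth_word N p = ws"
      using ex_growth_word ws(1) by blast
    then show "ws \<in> growth_word N ` avoiders N True True"
      using involution_on.good_growth_word_iff[OF p(1)] ws(2) by auto
  qed
qed

section \<open>Reverse-complement\<close>

definition rev_compl :: "nat \<Rightarrow> (nat \<Rightarrow> nat) \<Rightarrow> nat \<Rightarrow> nat" where
  "rev_compl n p i = (if i \<in> {1..n} then n + 1 - p (n + 1 - i) else i)"

lemma rev_compl:
  assumes "involution_on n p"
  shows "involution_on n (rev_compl n p)" "rev_compl n (rev_compl n p) = p"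
proof -
  interpret involution_on n p by fact
  have range: "p i \<in> {1..n}" if "i \<in> {1..n}" for i using permutes_in_image[OF permutes] that by blast
  have fixed: "p i = i" if "i \<notin> {1..n}" for i using permutes_not_in[OF permutes that] .
  have reflect: "n + 1 - i \<in> {1..n}" "n + 1 - (n + 1 - i) = i" if "i \<in> {1..n}" for i using that by auto
  have inv: "rev_compl n p (rev_compl n p i) = i" for i
  proof (cases "i \<in> {1..n}")
    case True
    then show ?thesis
      using reflect[OF True] range[OF reflect(1)[OF True]] reflect[OF range[OF reflect(1)[OF True]]] involutive
      by (simp add: rev_compl_def)
  qed (auto simp: rev_compl_def)
  have "rev_compl n p permutes {1..n}"
    unfolding permutes_def
  proof (intro conjI allI impI)
    show "\<exists>!x. rev_compl n p x = y" for y using inv by metis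
  qed (auto simp: rev_compl_def)
  then show "involution_on n (rev_compl n p)" using inv by unfold_locales
  show "rev_compl n (rev_compl n p) = p"
  proof
    fix i
    show "rev_compl n (rev_compl n p) i = p i"
    proof (cases "i \<in> {1..n}")
      case True
      then show ?thesis using reflect[of i] reflect[OF range[OF True]] by (simp add: rev_compl_def)
    next
      case False
      then show ?thesis using fixed[OF False] by (auto simp: rev_compl_def)
    qed
  qed
qed

lemma rev_compl_less_iff:
  assumes "p permutes {1..n}" "i \<in> {1..n}" "j \<in> {1..n}"
  shows "rev_compl n p i < rev_compl n p j \<longleftrightarrow> p (n + 1 - j) < p (n + 1 - i)"
proof -
  have "n + 1 - i \<in> {1..n}" "n + 1 - j \<in> {1..n}" using assms by auto
  then have "p (n + 1 - i) \<in> {1..n}" "p (n + 1 - j) \<in> {1..n}"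
    using permutes_in_image[OF assms(1)] by blast+
  moreover have "n + 1 - x < n + 1 - y \<longleftrightarrow> y < x" if "x \<in> {1..n}" "y \<in> {1..n}" for x y
    using that by auto
  ultimately show ?thesis using assms(2,3) by (simp add: rev_compl_def)
qed

text \<open>Turning the diagram by 180 degrees keeps ascents and descents but exchanges the two
  summands of the pattern.\<close>

lemma occurs_rev_compl_imp:
  assumes p: "p permutes {1..n}" and occ: "occurs n u t (rev_compl n p)"
  shows "occurs n t u p"
proof -
  obtain i1 i2 i3 i4 where i: "1 \<le> i1" "i1 < i2" "i2 < i3" "i3 < i4" "i4 \<le> n"
    and d: "dir u (rev_compl n p i1) (rev_compl n p i2)" "dir t (rev_compl n p i3) (rev_compl n p i4)"
    and m: "max (rev_compl n p i1) (rev_compl n p i2) < min (rev_compl n p i3) (rev_compl n p i4)"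
    using occ unfolding occurs_four by blast
  have mem: "i1 \<in> {1..n}" "i2 \<in> {1..n}" "i3 \<in> {1..n}" "i4 \<in> {1..n}" using i by auto
  note lt = rev_compl_less_iff[OF p]
  define j1 j2 j3 j4 where "j1 = n + 1 - i4" and "j2 = n + 1 - i3" and "j3 = n + 1 - i2" and "j4 = n + 1 - i1"
  note j = this
  have "1 \<le> j1" "j1 < j2" "j2 < j3" "j3 < j4" "j4 \<le> n" using i by (auto simp: j)
  moreover have "dir t (p j1) (p j2)" "dir u (p j3) (p j4)"
    using d unfolding dir_def j lt[OF mem(1) mem(2)] lt[OF mem(2) mem(1)] lt[OF mem(3) mem(4)] lt[OF mem(4) mem(3)]
    by metis+
  moreover have "p j1 < p j3" "p j1 < p j4" "p j2 < p j3" "p j2 < p j4"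
    using m unfolding j lt[OF mem(1) mem(3), symmetric] lt[OF mem(1) mem(4), symmetric]
      lt[OF mem(2) mem(3), symmetric] lt[OF mem(2) mem(4), symmetric] by simp_all
  then have "max (p j1) (p j2) < min (p j3) (p j4)" by simp
  ultimately show ?thesis unfolding occurs_four by blast
qed

lemma occurs_rev_compl:
  assumes "involution_on n p"
  shows "occurs n u t (rev_compl n p) \<longleftrightarrow> occurs n t u p"
  using occurs_rev_compl_imp[of p n u t] occurs_rev_compl_imp[of "rev_compl n p" n t u]
    rev_compl[OF assms] assms unfolding involution_on_def by auto

lemma rev_compl_ascent:
  assumes "p permutes {1..n}" "1 \<le> i" "i < n"
  shows "rev_compl n p i < rev_compl n p (i + 1) \<longleftrightarrow> p (n - i) < p (n - i + 1)"
proof -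
  have "n + 1 - i = n - i + 1" "n + 1 - (i + 1) = n - i" "i \<in> {1..n}" "i + 1 \<in> {1..n}"
    using assms by auto
  then show ?thesis using rev_compl_less_iff[OF assms(1)] by metis
qed

lemma rev_compl_descent:
  assumes "p permutes {1..n}" "1 \<le> i" "i < n"
  shows "rev_compl n p (i + 1) < rev_compl n p i \<longleftrightarrow> p (n - i + 1) < p (n - i)"
proof -
  have "n + 1 - i = n - i + 1" "n + 1 - (i + 1) = n - i" "i \<in> {1..n}" "i + 1 \<in> {1..n}"
    using assms by auto
  then show ?thesis using rev_compl_less_iff[OF assms(1)] by metis
qed

lemma ball_reflect:
  fixes n :: nat
  shows "(\<forall>i. 1 \<le> i \<and> i < n \<longrightarrow> P (n - i)) \<longleftrightarrow> (\<forall>i. 1 \<le> i \<and> i < n \<longrightarrow> P i)"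
proof (intro iffI allI impI)
  fix i assume *: "\<forall>i. 1 \<le> i \<and> i < n \<longrightarrow> P (n - i)" and i: "1 \<le> i \<and> i < n"
  then show "P i" using spec[OF *, of "n - i"] by (simp add: Suc_le_eq)
qed auto

text \<open>The step at \<open>i\<close> comes from the step at \<open>n - i\<close> with its
  direction kept, and for even \<open>n\<close> both positions have the same parity.\<close>

lemma alternating_rev_compl_even:
  assumes "p permutes {1..n}" "even n"
  shows "alternating n (rev_compl n p) \<longleftrightarrow> alternating n p"
proof -
  have "alternating n (rev_compl n p) \<longleftrightarrow>
      (\<forall>i. 1 \<le> i \<and> i < n \<longrightarrow> (p (n - i) < p (n - i + 1) \<longleftrightarrow> odd (n - i)))"
    unfolding alternating_def using assms(2) by (intro all_cong) (auto simp: rev_compl_ascent[OF assms(1), simplified])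
  also have "\<dots> \<longleftrightarrow> alternating n p"
    unfolding alternating_def by (rule ball_reflect)
  finally show ?thesis .
qed

text \<open>For odd \<open>n\<close> the positions \<open>i\<close> and \<open>n - i\<close> have
  opposite parity, so the two kinds of alternation are exchanged.\<close>

lemma reverse_alternating_rev_compl_odd:
  assumes "p permutes {1..n}" "odd n"
  shows "reverse_alternating n (rev_compl n p) \<longleftrightarrow> alternating n p"
proof -
  have neq: "p (n - i) \<noteq> p (n - i + 1)" for i
    using permutes_inj[OF assms(1)] by (auto simp: inj_eq)
  have "reverse_alternating n (rev_compl n p) \<longleftrightarrow>
      (\<forall>i. 1 \<le> i \<and> i < n \<longrightarrow> (p (n - i) < p (n - i + 1) \<longleftrightarrow> odd (n - i)))"
    unfolding reverse_alternating_def
  proof (intro all_cong)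
    fix i assume i: "1 \<le> i \<and> i < n"
    then have "odd (n - i) \<longleftrightarrow> even i" using assms(2) by auto
    moreover have "rev_compl n p (i + 1) < rev_compl n p i \<longleftrightarrow> \<not> p (n - i) < p (n - i + 1)"
      using rev_compl_descent[OF assms(1), of i] i neq[of i] by linarith
    ultimately show "(rev_compl n p (i + 1) < rev_compl n p i \<longleftrightarrow> odd i) \<longleftrightarrow>
        (p (n - i) < p (n - i + 1) \<longleftrightarrow> odd (n - i))"
      by blast
  qed
  also have "\<dots> \<longleftrightarrow> alternating n p"
    unfolding alternating_def by (rule ball_reflect)
  finally show ?thesis .
qed

lemma card_avoiders_rev_compl:
  assumes "even n"
  shows "card (avoiders n u t) = card (avoiders n t u)"
proof (rule bij_betw_same_card[of "rev_compl n"], rule bij_betw_byWitness[of _ "rev_compl n"])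
  show "\<forall>p\<in>avoiders n u t. rev_compl n (rev_compl n p) = p" "\<forall>p\<in>avoiders n t u. rev_compl n (rev_compl n p) = p"
    using rev_compl(2) by (auto simp: avoiders_def)
  have "rev_compl n ` avoiders n u t \<subseteq> avoiders n t u" for u t
  proof (rule image_subsetI)
    fix p assume p: "p \<in> avoiders n u t"
    then have inv: "involution_on n p" by (simp add: avoiders_def)
    then show "rev_compl n p \<in> avoiders n t u"
      using p alternating_rev_compl_even[OF _ assms] occurs_rev_compl[OF inv] rev_compl(1)[OF inv]
      by (auto simp: avoiders_def involution_on_def)
  qed
  then show "rev_compl n ` avoiders n u t \<subseteq> avoiders n t u" "rev_compl n ` avoiders n t u \<subseteq> avoiders n u t"
    by blast+
qed

lemma RAI_avoiding_eq:
  "RAI_avoiding n [1, 2, 4, 3] =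
    {p. involution_on n p \<and> reverse_alternating n p \<and> \<not> occurs n True False p}"
  unfolding RAI_avoiding_def RAI_def involution_on_iff contains_iff_occurs by auto

lemma card_RAI_avoiding:
  assumes "odd n"
  shows "card (RAI_avoiding n [1, 2, 4, 3]) = card (avoiders n False True)"
  unfolding RAI_avoiding_eq
proof (rule bij_betw_same_card[of "rev_compl n"], rule bij_betw_byWitness[of _ "rev_compl n"])
  let ?R = "{p. involution_on n p \<and> reverse_alternating n p \<and> \<not> occurs n True False p}"
  show "\<forall>p\<in>?R. rev_compl n (rev_compl n p) = p"
    "\<forall>p\<in>avoiders n False True. rev_compl n (rev_compl n p) = p"
    using rev_compl(2) by (auto simp: avoiders_def)
  show "rev_compl n ` ?R \<subseteq> avoiders n False True"
  proof (rule image_subsetI)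
    fix p assume p: "p \<in> ?R"
    then have inv: "involution_on n p" by simp
    note inv' = rev_compl(1)[OF inv]
    have "alternating n (rev_compl n p) \<longleftrightarrow> reverse_alternating n p"
      using reverse_alternating_rev_compl_odd[OF _ assms, of "rev_compl n p"] inv' rev_compl(2)[OF inv]
      by (simp add: involution_on_def)
    then show "rev_compl n p \<in> avoiders n False True"
      using p inv' occurs_rev_compl[OF inv] by (simp add: avoiders_def)
  qed
  show "rev_compl n ` avoiders n False True \<subseteq> ?R"
  proof (rule image_subsetI)
    fix p assume p: "p \<in> avoiders n False True"
    then have inv: "involution_on n p" by (simp add: avoiders_def)
    then show "rev_compl n p \<in> ?R"
      using p reverse_alternating_rev_compl_odd[OF _ assms] occurs_rev_compl[OF inv] rev_compl(1)[OF inv]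
      by (simp add: avoiders_def involution_on_def)
  qed
qed

theorem theorem7p1:
  fixes n :: nat
  assumes "n \<ge> 1"
  shows "card (AI_avoiding (2 * n) [1, 2, 4, 3]) = motzkin (int n)
    \<and> card (AI_avoiding (2 * n) [2, 1, 4, 3]) = motzkin (int n)
    \<and> card (AI_avoiding (2 * n) [2, 1, 3, 4]) = motzkin (int n)
    \<and> int (card (AI_avoiding (2 * n - 1) [2, 1, 3, 4])) =
        int (motzkin (int n)) - int (motzkin (int n - 2))
    \<and> int (card (RAI_avoiding (2 * n - 1) [1, 2, 4, 3])) =
        int (motzkin (int n)) - int (motzkin (int n - 2))"
proof -
  have even: "card (avoiders (2 * n) True True) = motzkin (int n)"
    by (simp add: card_avoiders_increasing card_good_words_even)
  have odd: "int (card (avoiders (2 * n - 1) True True)) =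
      int (motzkin (int n)) - int (motzkin (int n - 2))"
    using card_good_words_odd[OF assms] by (simp add: card_avoiders_increasing)
  have "odd (2 * n - 1)" using assms by simp
  \<comment> \<open>Refilling links \<open>1234\<close> with \<open>2134\<close> and
    \<open>1243\<close> with \<open>2143\<close>; the reverse-complement links \<open>2134\<close>
    with \<open>1243\<close>, within alternating involutions in even length and passing to reverse
    alternating ones in odd length.\<close>
  then show ?thesis
    using even odd card_avoiders_eq[of "2 * n" True True False] card_avoiders_eq[of "2 * n" True False False]
      card_avoiders_rev_compl[of "2 * n" True False] card_avoiders_eq[of "2 * n - 1" True True False]
      card_RAI_avoiding[of "2 * n - 1"]
    unfolding AI_avoiding_eq by simp
qed

end
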